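(* Let $\kappa=(\kappa(j))_{j\in\mathbb Z}$ be i.i.d. real random variables with mean zero and variance $1$, supported in an interval $[-\alpha,\alpha]$, with $\sigma\ge0$, $\sigma\alpha<1$. Let $c_*\in(c_-,c_+)$ and let $\{\mathcal A_{c_*t,c_*}\}_{t\in\mathbb R}$ satisfy the linear stability hypothesis (LS) stated in the context. Let $\overline\eta(j,t)\in\mathbb R^2$ be the solution of $$\dot{\overline\eta}(j,t)=\mathcal J\mathcal A_{c_*t,c_*}\overline\eta(j,t)+T^{1,0}(c_*t,c_* )[\kappa](j),\qquad\overline\eta(j,0)=0,\quad j\in\mathbb Z,\ t\ge0.$$ Then there exists a (random) function $\overline\eta^\infty:\mathbb R\to\mathbb R^2$ such that for each $j\in\mathbb Z$ and $p\in[0,1)$, the sequence of random variables $$\Big(\overline\eta\big(j+n,(n+p)/c_*\big)\Big)_{n\ge1}$$ converges in distribution to $\overline\eta^\infty(j-p)$.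
   Context: Notation: $\delta_+f(j)=f(j+1)-f(j)$, $\delta_-f(j)=f(j)-f(j-1)$, $\mathcal J(r,p)^\top=(\delta_+p,\ \delta_-r)^\top$. Solitary waves (Friesecke–Pego): there is $c_+>1$ such that for each $c\in(1,c_+]$ there is a smooth, exponentially decaying profile $\phi_c=(r_c,p_c)^\top:\mathbb R\to\mathbb R^2$ (smooth also in $c$) solving $-c\phi_c'=\mathcal J(r_c+r_c^2,\ p_c)^\top$. Write $\phi_{\xi,c}=(r_{\xi,c},p_{\xi,c})^\top=\phi_c(\cdot-\xi)$; $\partial_\xi,\partial_c$ are derivatives in these parameters (so $\partial_\xi\phi_{\xi,c}=-\phi_c'(\cdot-\xi)$); functions on $\mathbb R$ are restricted to $\mathbb Z$ when used as sequences. Symplectic form: $\delta_+^{-1}f(j)=\sum_{d=-\infty}^{-1}f(j+d)$, $\delta_-^{-1}f(j)=\sum_{d=-\infty}^{0}f(j+d)$, $\mathcal J^{-1}(f_1,f_2)^\top=(\delta_-^{-1}f_2,\ \delta_+^{-1}f_1)^\top$, $\Omega(f,g)=\langle\mathcal J^{-1}f,g\rangle_{\ell^2(\mathbb Z;\mathbb R^2)}$. Known: the matrix with rows $(\Omega(\partial_\xi\phi_{\xi,c},\partial_\xi\phi_{\xi,c}),\Omega(\partial_\xi\phi_{\xi,c},\partial_c\phi_{\xi,c}))$ and $(\Omega(\partial_c\phi_{\xi,c},\partial_\xi\phi_{\xi,c}),\Omega(\partial_c\phi_{\xi,c},\partial_c\phi_{\xi,c}))$ equals $A(c)=\begin{bmatrix}0&\alpha_0(c)\\-\alpha_0(c)&\alpha_1(c)\end{bmatrix}$,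 independent of $\xi$, with $\alpha_0(c)=\frac1c\frac{d}{dc}\sum_{j\in\mathbb Z}\big(\frac12p_c(j)^2+\frac12r_c(j)^2+\frac13r_c(j)^3\big)>0$ and $\alpha_1(c)=-\big(\frac{d}{dc}\int_{\mathbb R}r_c\big)\frac{d}{dc}\big(c\int_{\mathbb R}r_c\big)$. Fixed constants: $c_-\in(1,c_+)$ and a weight $a>0$ (coming from the Friesecke–Pego exponential linear stability theorem for speeds in $[c_-,c_+]$); the profiles and their derivatives in $\xi$ and $c$ decay exponentially at some rate $\beta>a$. Forcing: for $f\in\ell^\infty(\mathbb Z;\mathbb R)$, $$\begin{bmatrix}\Gamma^{1,0}(\xi,c)[f]\\ C^{1,0}(\xi,c)[f]\end{bmatrix}=-\tfrac12A^{-1}(c)\begin{bmatrix}\langle\partial_\xi(r_{\xi,c}^2),f\rangle_{\ell^2}\\ \langle\partial_c(r_{\xi,c}^2),f\rangle_{\ell^2}\end{bmatrix},$$ $$T^{1,0}(\xi,c)[f]=-\Gamma^{1,0}(\xi,c)[f]\,\partial_\xi\phi_{\xi,c}-C^{1,0}(\xi,c)[f]\,\partial_c\phi_{\xi,c}+\begin{bmatrix}0\\ \delta_-(f\,r_{\xi,c})\end{bmatrix}.$$ Hypothesis (LS): $c_*\in(c_-,c_+)$ and $\{\mathcal A_{c_*t,c_*}\}_{t\in\mathbb R}$ is a family of bounded linear operators on $\ell^2(\mathbb Z;\mathbb R^2)$ with $[\mathcal A_{c_*t,c_*}\eta](j+d)=[\mathcal A_{c_*t-d,c_*}\eta(\cdot+d)](j)$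 for all $j,d\in\mathbb Z$, $t\in\mathbb R$. The operators $\{\mathcal J\mathcal A_{c_*t,c_*}\}_{t\in\mathbb R}$ generate an evolution family $\{U_{c_*}(t,s)\}_{t\ge s}$ on $\ell^2(\mathbb Z;\mathbb R^2)$, and there are $K,b>0$ such that $$\|e^{a(\cdot-c_*t)}U_{c_*}(t,s)w\|_{\ell^2}\le Ke^{-b(t-s)}\|e^{a(\cdot-c_*s)}w\|_{\ell^2},\quad t\ge s,$$ provided $\Omega(\partial_\xi\phi_{c_*}(\cdot-c_*s),w)=\Omega(\partial_c\phi_{c_*}(\cdot-c_*s),w)=0$. *)

theory Defs
  imports "HOL-Probability.Probability"
begin

section \<open>The Hilbert space of square-summable sequences\<close>

typedef ell2 = "{w :: int \<Rightarrow> real^2. (\<lambda>j. (norm (w j))\<^sup>2) summable_on UNIV}"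
  morphisms ell2_seq Abs_ell2
  by (intro exI[of _ "\<lambda>_. 0"]) simp

setup_lifting type_definition_ell2

lemma ell2_seq_summable: "(\<lambda>j. (norm (ell2_seq w j))\<^sup>2) summable_on UNIV"
  using ell2_seq[of w] by simp

lemma square_summable_add:
  fixes v w :: "int \<Rightarrow> real^2"
  assumes "(\<lambda>j. (norm (v j))\<^sup>2) summable_on UNIV" "(\<lambda>j. (norm (w j))\<^sup>2) summable_on UNIV"
  shows "(\<lambda>j. (norm (v j + w j))\<^sup>2) summable_on UNIV"
proof (rule summable_on_comparison_test)
  show "(\<lambda>j. 2 * (norm (v j))\<^sup>2 + 2 * (norm (w j))\<^sup>2) summable_on UNIV"
    using assms by (intro summable_on_add summable_on_cmult_right)
  fix j
  have "(norm (v j + w j))\<^sup>2 \<le> (norm (v j) + norm (w j))\<^sup>2"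
    by (intro power_mono norm_triangle_ineq) auto
  also have "\<dots> \<le> 2 * (norm (v j))\<^sup>2 + 2 * (norm (w j))\<^sup>2"
    using sum_squares_bound[of "norm (v j)" "norm (w j)"] by (simp add: power2_sum)
  finally show "(norm (v j + w j))\<^sup>2 \<le> 2 * (norm (v j))\<^sup>2 + 2 * (norm (w j))\<^sup>2" .
qed auto

lemma square_summable_scaleR:
  fixes w :: "int \<Rightarrow> real^2"
  assumes "(\<lambda>j. (norm (w j))\<^sup>2) summable_on UNIV"
  shows "(\<lambda>j. (norm (a *\<^sub>R w j))\<^sup>2) summable_on UNIV"
  using assms by (simp add: power_mult_distrib summable_on_cmult_right)

lemma square_summable_shift:
  fixes w :: "int \<Rightarrow> real^2"
  assumes "(\<lambda>j. (norm (w j))\<^sup>2) summable_on UNIV"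
  shows "(\<lambda>j. (norm (w (j + d)))\<^sup>2) summable_on UNIV"
proof -
  have "bij_betw (\<lambda>j::int. j + d) UNIV UNIV"
    by (rule bij_betw_byWitness[where f' = "\<lambda>j. j - d"]) auto
  from summable_on_reindex_bij_betw[OF this, of "\<lambda>j. (norm (w j))\<^sup>2"] assms
  show ?thesis by simp
qed

lemma ell2_inner_summable: "(\<lambda>j. ell2_seq v j \<bullet> ell2_seq w j) summable_on UNIV"
proof (rule abs_summable_summable, rule summable_on_comparison_test)
  show "(\<lambda>j. (norm (ell2_seq v j))\<^sup>2 + (norm (ell2_seq w j))\<^sup>2) summable_on UNIV"
    by (intro summable_on_add ell2_seq_summable)
  fix j
  have "norm (ell2_seq v j \<bullet> ell2_seq w j) \<le> norm (ell2_seq v j) * norm (ell2_seq w j)"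
    by (metis Cauchy_Schwarz_ineq2 real_norm_def)
  also have "\<dots> \<le> (norm (ell2_seq v j))\<^sup>2 + (norm (ell2_seq w j))\<^sup>2"
    using sum_squares_bound[of "norm (ell2_seq v j)" "norm (ell2_seq w j)"]
      mult_nonneg_nonneg[OF norm_ge_zero[of "ell2_seq v j"] norm_ge_zero[of "ell2_seq w j"]]
    by linarith
  finally show "norm (ell2_seq v j \<bullet> ell2_seq w j) \<le> (norm (ell2_seq v j))\<^sup>2 + (norm (ell2_seq w j))\<^sup>2" .
qed auto

instantiation ell2 :: real_vector
begin

lift_definition zero_ell2 :: ell2 is "\<lambda>_. 0" by simp

lift_definition plus_ell2 :: "ell2 \<Rightarrow> ell2 \<Rightarrow> ell2" is "\<lambda>v w j. v j + w j"
  using square_summable_add by simp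

lift_definition scaleR_ell2 :: "real \<Rightarrow> ell2 \<Rightarrow> ell2" is "\<lambda>a w j. a *\<^sub>R w j"
  using square_summable_scaleR by blast

lift_definition uminus_ell2 :: "ell2 \<Rightarrow> ell2" is "\<lambda>w j. - w j" by simp

definition minus_ell2 :: "ell2 \<Rightarrow> ell2 \<Rightarrow> ell2" where "v - w = v + - w" for v w :: ell2

instance
  by standard
    (simp_all add: ell2_seq_inject[symmetric] fun_eq_iff minus_ell2_def zero_ell2.rep_eq
      plus_ell2.rep_eq scaleR_ell2.rep_eq uminus_ell2.rep_eq algebra_simps)

end

instantiation ell2 :: real_inner
begin

definition inner_ell2 :: "ell2 \<Rightarrow> ell2 \<Rightarrow> real"
  where "v \<bullet> w = (\<Sum>\<^sub>\<infinity>j. ell2_seq v j \<bullet> ell2_seq w j)"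

definition norm_ell2 :: "ell2 \<Rightarrow> real" where "norm w = sqrt (w \<bullet> w)" for w :: ell2

definition dist_ell2 :: "ell2 \<Rightarrow> ell2 \<Rightarrow> real" where "dist v w = norm (v - w)" for v w :: ell2

definition sgn_ell2 :: "ell2 \<Rightarrow> ell2" where "sgn w = w /\<^sub>R norm w" for w :: ell2

definition uniformity_ell2 :: "(ell2 \<times> ell2) filter"
  where "uniformity_ell2 = (INF e\<in>{0<..}. principal {(v, w). dist v w < e})"

definition open_ell2 :: "ell2 set \<Rightarrow> bool"
  where "open_ell2 S = (\<forall>v\<in>S. \<forall>\<^sub>F (v', w) in uniformity. v' = v \<longrightarrow> w \<in> S)"

instance
proof
  fix u v w :: ell2 and a :: real
  show "dist v w = norm (v - w)" by (rule dist_ell2_def)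
  show "sgn v = v /\<^sub>R norm v" by (rule sgn_ell2_def)
  show "uniformity = (INF e\<in>{0<..}. principal {(v :: ell2, w). dist v w < e})"
    by (rule uniformity_ell2_def)
  show "open S = (\<forall>v\<in>S. \<forall>\<^sub>F (v', w) in uniformity. v' = v \<longrightarrow> w \<in> S)" for S :: "ell2 set"
    by (rule open_ell2_def)
  show "v \<bullet> w = w \<bullet> v" by (simp add: inner_ell2_def inner_commute)
  show "(u + v) \<bullet> w = u \<bullet> w + v \<bullet> w"
    by (simp add: inner_ell2_def plus_ell2.rep_eq inner_add_left infsum_add ell2_inner_summable)
  show "(a *\<^sub>R v) \<bullet> w = a * (v \<bullet> w)"
    by (simp add: inner_ell2_def scaleR_ell2.rep_eq infsum_cmult_right ell2_inner_summable)
  show "0 \<le> v \<bullet> v" by (simp add: inner_ell2_def infsum_nonneg)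
  show "v \<bullet> v = 0 \<longleftrightarrow> v = 0"
  proof
    assume "v \<bullet> v = 0"
    then have "ell2_seq v j \<bullet> ell2_seq v j = 0" for j
      using nonneg_infsum_le_0D[OF _ ell2_inner_summable[of v v], of j]
      by (simp add: inner_ell2_def)
    then show "v = 0"
      by (intro ell2_seq_inject[THEN iffD1] ext) (simp add: zero_ell2.rep_eq)
  qed (simp add: inner_ell2_def zero_ell2.rep_eq)
  show "norm v = sqrt (v \<bullet> v)" by (rule norm_ell2_def)
qed

end

lift_definition shift_ell2 :: "int \<Rightarrow> ell2 \<Rightarrow> ell2" is "\<lambda>d w j. w (j + d)"
  using square_summable_shift by simp


section \<open>Difference operators and the symplectic form\<close>

text \<open>The first three operators act both on functions on the real line (profiles) and on
  functions on the integers.\<close>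

definition fdiff :: "('a::ring_1 \<Rightarrow> real) \<Rightarrow> 'a \<Rightarrow> real"
  where "fdiff f j = f (j + 1) - f j"

definition bdiff :: "('a::ring_1 \<Rightarrow> real) \<Rightarrow> 'a \<Rightarrow> real"
  where "bdiff f j = f j - f (j - 1)"

definition J_op :: "('a::ring_1 \<Rightarrow> real^2) \<Rightarrow> 'a \<Rightarrow> real^2"
  where "J_op w j = vector [fdiff (\<lambda>i. w i $ 2) j, bdiff (\<lambda>i. w i $ 1) j]"

lift_definition J_ell2 :: "ell2 \<Rightarrow> ell2" is J_op
proof -
  fix w :: "int \<Rightarrow> real^2"
  assume w: "(\<lambda>j. (norm (w j))\<^sup>2) summable_on UNIV"
  have n2: "(norm v)\<^sup>2 = (v $ 1)\<^sup>2 + (v $ 2)\<^sup>2" for v :: "real^2"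
    unfolding power2_norm_eq_inner inner_vec_def sum_2 by (simp add: power2_eq_square)
  have ineq: "(x - y)\<^sup>2 + (u - v)\<^sup>2
      \<le> 2 * (s\<^sup>2 + x\<^sup>2) + 4 * (u\<^sup>2 + y\<^sup>2) + 2 * (v\<^sup>2 + z\<^sup>2)" for x y u v s z :: real
  proof -
    have "0 \<le> (x + y)\<^sup>2 + (u + v)\<^sup>2 + 2 * s\<^sup>2 + 2 * u\<^sup>2 + 2 * y\<^sup>2 + 2 * z\<^sup>2" by simp
    then show ?thesis by (simp add: power2_sum power2_diff)
  qed
  show "(\<lambda>j. (norm (J_op w j))\<^sup>2) summable_on UNIV"
  proof (rule summable_on_comparison_test)
    show "(\<lambda>j. 2 * (norm (w (j + 1)))\<^sup>2 + 4 * (norm (w j))\<^sup>2 + 2 * (norm (w (j + - 1)))\<^sup>2)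
      summable_on UNIV"
      by (intro summable_on_add summable_on_cmult_right square_summable_shift w)
    fix j
    show "(norm (J_op w j))\<^sup>2
      \<le> 2 * (norm (w (j + 1)))\<^sup>2 + 4 * (norm (w j))\<^sup>2 + 2 * (norm (w (j + - 1)))\<^sup>2"
      unfolding n2 J_op_def fdiff_def bdiff_def vector_2 add_uminus_conv_diff
      by (rule ineq)
  qed auto
qed

definition fdiff_inv :: "(int \<Rightarrow> real) \<Rightarrow> int \<Rightarrow> real"
  where "fdiff_inv f j = (\<Sum>\<^sub>\<infinity>d\<in>{..-1}. f (j + d))"

definition bdiff_inv :: "(int \<Rightarrow> real) \<Rightarrow> int \<Rightarrow> real"
  where "bdiff_inv f j = (\<Sum>\<^sub>\<infinity>d\<in>{..0}. f (j + d))"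

definition J_inv :: "(int \<Rightarrow> real^2) \<Rightarrow> int \<Rightarrow> real^2"
  where "J_inv f j = vector [bdiff_inv (\<lambda>i. f i $ 2) j, fdiff_inv (\<lambda>i. f i $ 1) j]"

text \<open>Defined on plain sequences rather than on \<open>ell2\<close>: the sequence \<open>J_inv f\<close> is in general only
  bounded at \<open>+\<infinity>\<close>, so the pairing also relies on decay of \<open>g\<close> there.\<close>

definition \<Omega> :: "(int \<Rightarrow> real^2) \<Rightarrow> (int \<Rightarrow> real^2) \<Rightarrow> real"
  where "\<Omega> f g = (\<Sum>\<^sub>\<infinity>j. J_inv f j \<bullet> g j)"


section \<open>Solitary waves\<close>

text \<open>A wave family is a function \<open>\<phi>\<close> of the speed \<open>c\<close> and the spatial variable \<open>x\<close>, with
  \<open>\<phi> c x $ 1\<close> and \<open>\<phi> c x $ 2\<close> the components usually called \<open>r\<close> and \<open>p\<close>.\<close>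

text \<open>Continuous partial derivatives in \<open>(c, x)\<close> of all orders up to \<open>k\<close> on the strip
  \<open>I \<times> \<real>\<close>, one-sided in \<open>c\<close> at endpoints of \<open>I\<close>.\<close>

primrec Ck_on :: "nat \<Rightarrow> real set \<Rightarrow> (real \<Rightarrow> real \<Rightarrow> real^2) \<Rightarrow> bool" where
  "Ck_on 0 I f \<longleftrightarrow> continuous_on (I \<times> UNIV) (\<lambda>(c, x). f c x)"
| "Ck_on (Suc k) I f \<longleftrightarrow> continuous_on (I \<times> UNIV) (\<lambda>(c, x). f c x) \<and>
     (\<exists>fc fx. (\<forall>c\<in>I. \<forall>x.
          ((\<lambda>c'. f c' x) has_vector_derivative fc c x) (at c within I) \<and>
          (f c has_vector_derivative fx c x) (at x)) \<and>
        Ck_on k I fc \<and> Ck_on k I fx)"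

definition solitary_wave_family :: "real \<Rightarrow> (real \<Rightarrow> real \<Rightarrow> real^2) \<Rightarrow> bool"
  where "solitary_wave_family c_plus \<phi> \<longleftrightarrow>
    1 < c_plus \<and>
    (\<forall>k. Ck_on k {1<..c_plus} \<phi>) \<and>
    (\<forall>c\<in>{1<..c_plus}.
      (\<exists>C. \<exists>\<nu>>0. \<forall>x. norm (\<phi> c x) \<le> C * exp (- \<nu> * \<bar>x\<bar>)) \<and>
      (\<forall>x. - c *\<^sub>R vector_derivative (\<phi> c) (at x)
           = J_op (\<lambda>y. vector [\<phi> c y $ 1 + (\<phi> c y $ 1)\<^sup>2, \<phi> c y $ 2]) x))"

text \<open>The wave centred at \<open>\<xi>\<close> and its parameter derivatives, as functions on the lattice.
  They are only ever used at speeds in the open interval below \<open>c_plus\<close>, so that two-sided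
  derivatives in \<open>c\<close> are appropriate.\<close>

definition wave :: "(real \<Rightarrow> real \<Rightarrow> real^2) \<Rightarrow> real \<Rightarrow> real \<Rightarrow> int \<Rightarrow> real^2"
  where "wave \<phi> \<xi> c j = \<phi> c (of_int j - \<xi>)"

definition d_xi :: "(real \<Rightarrow> real \<Rightarrow> real^2) \<Rightarrow> real \<Rightarrow> real \<Rightarrow> int \<Rightarrow> real^2"
  where "d_xi \<phi> \<xi> c j = vector_derivative (\<lambda>\<xi>'. wave \<phi> \<xi>' c j) (at \<xi>)"

definition d_c :: "(real \<Rightarrow> real \<Rightarrow> real^2) \<Rightarrow> real \<Rightarrow> real \<Rightarrow> int \<Rightarrow> real^2"
  where "d_c \<phi> \<xi> c j = vector_derivative (\<lambda>c'. wave \<phi> \<xi> c' j) (at c)"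

text \<open>Only first derivatives are required to decay; the constant may depend on the speed.\<close>

definition decays_faster :: "real \<Rightarrow> real \<Rightarrow> real \<Rightarrow> (real \<Rightarrow> real \<Rightarrow> real^2) \<Rightarrow> bool"
  where "decays_faster a c_minus c_plus \<phi> \<longleftrightarrow>
    (\<exists>\<beta>>a. \<forall>c\<in>{c_minus..<c_plus}. \<exists>C. \<forall>x.
       norm (\<phi> c x) \<le> C * exp (- \<beta> * \<bar>x\<bar>) \<and>
       norm (vector_derivative (\<phi> c) (at x)) \<le> C * exp (- \<beta> * \<bar>x\<bar>) \<and>
       norm (vector_derivative (\<lambda>c'. \<phi> c' x) (at c)) \<le> C * exp (- \<beta> * \<bar>x\<bar>))"

definition \<alpha>\<^sub>0 :: "(real \<Rightarrow> real \<Rightarrow> real^2) \<Rightarrow> real \<Rightarrow> real"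
  where "\<alpha>\<^sub>0 \<phi> c = 1 / c * deriv (\<lambda>c'. \<Sum>\<^sub>\<infinity>j::int.
     1/2 * (\<phi> c' (of_int j) $ 2)\<^sup>2 + 1/2 * (\<phi> c' (of_int j) $ 1)\<^sup>2
       + 1/3 * (\<phi> c' (of_int j) $ 1) ^ 3) c"

definition \<alpha>\<^sub>1 :: "(real \<Rightarrow> real \<Rightarrow> real^2) \<Rightarrow> real \<Rightarrow> real"
  where "\<alpha>\<^sub>1 \<phi> c = - deriv (\<lambda>c'. LINT x|lborel. \<phi> c' x $ 1) c
     * deriv (\<lambda>c'. c' * (LINT x|lborel. \<phi> c' x $ 1)) c"

definition A_mat :: "(real \<Rightarrow> real \<Rightarrow> real^2) \<Rightarrow> real \<Rightarrow> real^2^2"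
  where "A_mat \<phi> c = vector [vector [0, \<alpha>\<^sub>0 \<phi> c], vector [- \<alpha>\<^sub>0 \<phi> c, \<alpha>\<^sub>1 \<phi> c]]"

text \<open>The known form of the symplectic Gram matrix of the tangent vectors.\<close>

definition symplectic_gram :: "real \<Rightarrow> (real \<Rightarrow> real \<Rightarrow> real^2) \<Rightarrow> bool"
  where "symplectic_gram c_plus \<phi> \<longleftrightarrow>
    (\<forall>c\<in>{1<..<c_plus}. \<alpha>\<^sub>0 \<phi> c > 0 \<and>
      (\<forall>\<xi>. vector
         [vector [\<Omega> (d_xi \<phi> \<xi> c) (d_xi \<phi> \<xi> c), \<Omega> (d_xi \<phi> \<xi> c) (d_c \<phi> \<xi> c)],
          vector [\<Omega> (d_c \<phi> \<xi> c) (d_xi \<phi> \<xi> c), \<Omega> (d_c \<phi> \<xi> c) (d_c \<phi> \<xi> c)]]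
       = A_mat \<phi> c))"


section \<open>The forcing term\<close>

text \<open>The vector with components \<open>\<Gamma>\<^bsup>1,0\<^esup>(\<xi>, c)[f]\<close> and \<open>C\<^bsup>1,0\<^esup>(\<xi>, c)[f]\<close>.\<close>

definition modulation :: "(real \<Rightarrow> real \<Rightarrow> real^2) \<Rightarrow> real \<Rightarrow> real \<Rightarrow> (int \<Rightarrow> real) \<Rightarrow> real^2"
  where "modulation \<phi> \<xi> c f = (- 1/2) *\<^sub>R (matrix_inv (A_mat \<phi> c) *v vector
     [\<Sum>\<^sub>\<infinity>j. deriv (\<lambda>\<xi>'. (wave \<phi> \<xi>' c j $ 1)\<^sup>2) \<xi> * f j,
      \<Sum>\<^sub>\<infinity>j. deriv (\<lambda>c'. (wave \<phi> \<xi> c' j $ 1)\<^sup>2) c * f j])"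

definition forcing :: "(real \<Rightarrow> real \<Rightarrow> real^2) \<Rightarrow> real \<Rightarrow> real \<Rightarrow> (int \<Rightarrow> real) \<Rightarrow> int \<Rightarrow> real^2"
  where "forcing \<phi> \<xi> c f j =
     - (modulation \<phi> \<xi> c f $ 1) *\<^sub>R d_xi \<phi> \<xi> c j
     - (modulation \<phi> \<xi> c f $ 2) *\<^sub>R d_c \<phi> \<xi> c j
     + vector [0, bdiff (\<lambda>i. f i * wave \<phi> \<xi> c i $ 1) j]"


section \<open>Linear stability\<close>

text \<open>Evolution family generated by the operators \<open>G t\<close>: a strongly continuous two-parameter
  family satisfying the forward and backward equations on the whole space.\<close>

definition generates_evolution_family ::
    "(real \<Rightarrow> ell2 \<Rightarrow> ell2) \<Rightarrow> (real \<Rightarrow> real \<Rightarrow> ell2 \<Rightarrow>\<^sub>L ell2) \<Rightarrow> bool"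
  where "generates_evolution_family G U \<longleftrightarrow>
    (\<forall>s. U s s = id_blinfun) \<and>
    (\<forall>t r s. s \<le> r \<and> r \<le> t \<longrightarrow> U t s = U t r o\<^sub>L U r s) \<and>
    (\<forall>w. continuous_on {(t, s). s \<le> t} (\<lambda>(t, s). U t s w)) \<and>
    (\<forall>w t s. s \<le> t \<longrightarrow>
       ((\<lambda>t'. U t' s w) has_vector_derivative G t (U t s w)) (at t within {s..}) \<and>
       ((\<lambda>s'. U t s' w) has_vector_derivative - U t s (G s w)) (at s within {..t}))"

definition weighted_summable :: "real \<Rightarrow> real \<Rightarrow> (int \<Rightarrow> real^2) \<Rightarrow> bool"
  where "weighted_summable a y w \<longleftrightarrow>
    (\<lambda>j. (norm (exp (a * (of_int j - y)) *\<^sub>R w j))\<^sup>2) summable_on UNIV"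

definition weighted_norm :: "real \<Rightarrow> real \<Rightarrow> (int \<Rightarrow> real^2) \<Rightarrow> real"
  where "weighted_norm a y w = sqrt (\<Sum>\<^sub>\<infinity>j. (norm (exp (a * (of_int j - y)) *\<^sub>R w j))\<^sup>2)"

text \<open>The family \<open>A\<close> is indexed by the position \<open>\<xi> = c t\<close>. The decay estimate is
  void unless the weighted norm on its right-hand side is finite.\<close>

definition linearly_stable ::
    "(real \<Rightarrow> real \<Rightarrow> real^2) \<Rightarrow> real \<Rightarrow> real \<Rightarrow> (real \<Rightarrow> ell2 \<Rightarrow>\<^sub>L ell2) \<Rightarrow> bool"
  where "linearly_stable \<phi> a c A \<longleftrightarrow>
    (\<forall>\<eta> j d t. ell2_seq (A (c * t) \<eta>) (j + d)
             = ell2_seq (A (c * t - of_int d) (shift_ell2 d \<eta>)) j) \<and>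
    (\<exists>U. generates_evolution_family (\<lambda>t w. J_ell2 (A (c * t) w)) U \<and>
      (\<exists>K>0. \<exists>b>0. \<forall>t s w. s \<le> t \<longrightarrow>
         weighted_summable a (c * s) (ell2_seq w) \<longrightarrow>
         \<Omega> (d_xi \<phi> (c * s) c) (ell2_seq w) = 0 \<longrightarrow>
         \<Omega> (d_c \<phi> (c * s) c) (ell2_seq w) = 0 \<longrightarrow>
         weighted_summable a (c * t) (ell2_seq (U t s w)) \<and>
         weighted_norm a (c * t) (ell2_seq (U t s w))
           \<le> K * exp (- b * (t - s)) * weighted_norm a (c * s) (ell2_seq w)))"

text \<open>\<open>\<eta>\<close> is a differentiable curve in \<open>ell2\<close> solving the forced linear equation with zero
  initial value; \<open>F\<close> is the forcing sequence regarded as an element of \<open>ell2\<close>.\<close>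

definition solves_forced_equation ::
    "(real \<Rightarrow> real \<Rightarrow> real^2) \<Rightarrow> real \<Rightarrow> (real \<Rightarrow> ell2 \<Rightarrow>\<^sub>L ell2) \<Rightarrow> (int \<Rightarrow> real)
      \<Rightarrow> (int \<Rightarrow> real \<Rightarrow> real^2) \<Rightarrow> bool"
  where "solves_forced_equation \<phi> c A f \<eta> \<longleftrightarrow>
    (\<exists>H. (\<forall>t\<ge>0. \<forall>j. \<eta> j t = ell2_seq (H t) j) \<and> H 0 = 0 \<and>
      (\<forall>t\<ge>0. \<exists>F. ell2_seq F = forcing \<phi> (c * t) c f \<and>
         (H has_vector_derivative J_ell2 (A (c * t) (H t)) + F) (at t within {0..})))"


section \<open>Convergence in distribution\<close>

text \<open>Measurability is part of the notion. For processes that are specified only almost surely,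
  such as solutions of an equation with random forcing that is bounded almost surely, it should be
  used with the completion of the underlying probability space.\<close>

definition converges_in_distribution ::
    "'w measure \<Rightarrow> (nat \<Rightarrow> 'w \<Rightarrow> 'b::topological_space) \<Rightarrow> ('w \<Rightarrow> 'b) \<Rightarrow> bool"
  where "converges_in_distribution M X Y \<longleftrightarrow>
    (\<forall>n. X n \<in> borel_measurable M) \<and> Y \<in> borel_measurable M \<and>
    (\<forall>g :: 'b \<Rightarrow> real. continuous_on UNIV g \<longrightarrow> bounded (range g) \<longrightarrow>
       (\<lambda>n. LINT y|distr M borel (X n). g y) \<longlonglongrightarrow> (LINT y|distr M borel Y. g y))"

end

theory Submission
  imports Defs
begin

text \<open>By Duhamel's formula in the frame moving with the wave, \<open>\<eta> (j + n) ((n + p) / c)\<close> is the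
  integral over \<open>s\<close> from \<open>- n / c\<close> to \<open>p / c\<close> of the \<open>j\<close>-th entry of
  \<open>U (p / c) s\<close> applied to the forcing by the noise translated by \<open>n\<close>. Translation does not
  change the law of an i.i.d. sequence, so the translated noise may be replaced by the original one.
  The forcing is symplectically orthogonal to the tangent vectors of the wave manifold and bounded in
  the weighted norm, so linear stability bounds the integrand by a multiple of \<open>exp (b * s)\<close>
  and the integrals converge for every bounded noise to the integral over \<open>{..p / c}\<close>.\<close>

section \<open>Sequence spaces and uniform boundedness\<close>

text \<open>Along one realization the values need not settle as \<open>n\<close> grows, since the
  wave keeps meeting new noise. A pathwise limit appears only after the translated noise is replaced
  by a copy of the same law that does not depend on \<open>n\<close>; hence convergence in
  distribution. Three obstacles shape the argument. The generator hypothesis gives the evolution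
  family only strong continuity, whereas the product rule behind Duhamel's formula needs operator
  norms that are bounded on compact time intervals; completeness of \<open>ell2\<close> and the
  Baire category theorem supply this bound. The translation is carried out on the solution curve,
  through the covariance of \<open>A\<close>, so that no translation property of \<open>U\<close>
  has to be derived. Noise and solution are controlled only almost surely: truncating the noise
  makes the response a continuous, hence Borel, function of all real sequences, and the solution,
  which agrees with it almost surely, is then measurable in the completed probability space.\<close>

lemma tendsto_infsum_dominated:
  fixes f :: "nat \<Rightarrow> 'a \<Rightarrow> real"
  assumes M: "M summable_on UNIV"
    and le: "\<And>n x. \<bar>f n x\<bar> \<le> M x"
    and lim: "\<And>x. (\<lambda>n. f n x) \<longlonglongrightarrow> g x"
  shows "(\<lambda>n. \<Sum>\<^sub>\<infinity>x. f n x) \<longlonglongrightarrow> (\<Sum>\<^sub>\<infinity>x. g x)"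
proof -
  have M0: "0 \<le> M x" for x using le[of 0 x] by linarith
  have g_le: "\<bar>g x\<bar> \<le> M x" for x
    by (rule LIMSEQ_le_const2[OF tendsto_rabs[OF lim]]) (use le in auto)
  have M_abs: "Infinite_Sum.abs_summable_on M UNIV" using M M0 by simp
  have abs: "Infinite_Sum.abs_summable_on h UNIV" if "\<And>x. \<bar>h x\<bar> \<le> M x" for h :: "'a \<Rightarrow> real"
    by (rule summable_on_comparison_test[OF M]) (use that in auto)
  \<comment> \<open>Absolutely convergent sums are integrals over the counting measure, where
    dominated convergence is available.\<close>
  have "integrable (count_space UNIV) M"
    using iffD1[OF abs_summable_equivalent M_abs] unfolding Infinite_Set_Sum.abs_summable_on_def .
  then have "(\<lambda>n. infsetsum (f n) UNIV) \<longlonglongrightarrow> infsetsum g UNIV"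
    unfolding infsetsum_def
    by (rule integral_dominated_convergence[rotated 2]) (use le lim in auto)
  then show ?thesis
    using infsetsum_infsum[OF iffD1[OF abs_summable_equivalent abs]] le g_le by simp
qed

lemma norm_ell2_power2: "(norm w)\<^sup>2 = (\<Sum>\<^sub>\<infinity>j. (norm (ell2_seq w j))\<^sup>2)"
  by (simp add: power2_norm_eq_inner inner_ell2_def)

lemma sum_norm_ell2_seq_le:
  assumes "finite F"
  shows "(\<Sum>j\<in>F. (norm (ell2_seq w j))\<^sup>2) \<le> (norm w)\<^sup>2"
  unfolding norm_ell2_power2
  by (rule finite_sum_le_infsum) (use assms in \<open>auto simp: ell2_seq_summable\<close>)

lemma norm_ell2_seq_le: "norm (ell2_seq w j) \<le> norm w"
  by (rule power2_le_imp_le) (use sum_norm_ell2_seq_le[of "{j}" w] in simp_all)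

lemma ell2_seq_diff: "ell2_seq (v - w) j = ell2_seq v j - ell2_seq w j"
  unfolding minus_ell2_def plus_ell2.rep_eq uminus_ell2.rep_eq by simp

lemma bounded_linear_ell2_seq: "bounded_linear (\<lambda>w. ell2_seq w j)"
  by (rule bounded_linear_intro[where K = 1])
    (simp_all add: plus_ell2.rep_eq scaleR_ell2.rep_eq norm_ell2_seq_le)

lemma ell2_seq_Abs_ell2:
  assumes "(\<lambda>j. (norm (h j))\<^sup>2) summable_on UNIV"
  shows "ell2_seq (Abs_ell2 h) = h"
  using assms by (simp add: Abs_ell2_inverse)

text \<open>The squared distance is a sum dominated by \<open>4 * (M j)\<^sup>2\<close>. This is how
  continuity of the forcing in norm is later reduced to continuity at each lattice site.\<close>

lemma tendsto_ell2_dominated: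
  fixes X :: "nat \<Rightarrow> ell2"
  assumes M: "(\<lambda>j. (M j)\<^sup>2) summable_on UNIV"
    and le: "\<And>n j. norm (ell2_seq (X n) j) \<le> M j"
    and lim: "\<And>j. (\<lambda>n. ell2_seq (X n) j) \<longlonglongrightarrow> ell2_seq Y j"
  shows "X \<longlonglongrightarrow> Y"
proof -
  have Y_le: "norm (ell2_seq Y j) \<le> M j" for j
    by (rule LIMSEQ_le_const2[OF tendsto_norm[OF lim]]) (use le in auto)
  have "(\<lambda>n. \<Sum>\<^sub>\<infinity>j. (norm (ell2_seq (X n - Y) j))\<^sup>2) \<longlonglongrightarrow> (\<Sum>\<^sub>\<infinity>j::int. 0)"
  proof (rule tendsto_infsum_dominated)
    show "(\<lambda>j. 4 * (M j)\<^sup>2) summable_on UNIV" by (intro summable_on_cmult_right M)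
    fix j n
    have "norm (ell2_seq (X n - Y) j) \<le> 2 * M j"
      unfolding ell2_seq_diff using norm_triangle_ineq4[of "ell2_seq (X n) j" "ell2_seq Y j"]
        le[of n j] Y_le[of j] by linarith
    then have "(norm (ell2_seq (X n - Y) j))\<^sup>2 \<le> (2 * M j)\<^sup>2" by (rule power_mono) simp
    then show "\<bar>(norm (ell2_seq (X n - Y) j))\<^sup>2\<bar> \<le> 4 * (M j)\<^sup>2" by (simp add: power_mult_distrib)
  next
    fix j
    have "(\<lambda>n. (norm (ell2_seq (X n) j - ell2_seq Y j))\<^sup>2) \<longlonglongrightarrow> (norm (ell2_seq Y j - ell2_seq Y j))\<^sup>2"
      by (intro tendsto_intros lim)
    then show "(\<lambda>n. (norm (ell2_seq (X n - Y) j))\<^sup>2) \<longlonglongrightarrow> 0" by (simp add: ell2_seq_diff)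
  qed
  then have "(\<lambda>n. sqrt ((norm (X n - Y))\<^sup>2)) \<longlonglongrightarrow> sqrt 0"
    unfolding norm_ell2_power2 by (intro tendsto_real_sqrt) simp
  then have "(\<lambda>n. norm (X n - Y)) \<longlonglongrightarrow> 0" by simp
  then have "(\<lambda>n. X n - Y) \<longlonglongrightarrow> 0" by (rule tendsto_norm_zero_cancel)
  then show ?thesis by (rule LIM_zero_cancel)
qed

text \<open>Completeness is what admits \<open>ell2\<close> to the Baire argument below.\<close>

instance ell2 :: banach
proof
  fix X :: "nat \<Rightarrow> ell2"
  assume X: "Cauchy X"
  have "\<exists>l. (\<lambda>n. ell2_seq (X n) j) \<longlonglongrightarrow> l" for j
    using bounded_linear.Cauchy[OF bounded_linear_ell2_seq X]
    by (simp add: Cauchy_convergent_iff convergent_def)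
  then obtain h where h: "(\<lambda>n. ell2_seq (X n) j) \<longlonglongrightarrow> h j" for j by metis
  \<comment> \<open>Bounds on finite partial sums survive the coordinatewise limit. With
    \<open>v = 0\<close> this puts \<open>h\<close> into the space, with \<open>v\<close> a member
    of the sequence it gives convergence in norm.\<close>
  have fatou: "(\<Sum>j\<in>F. (norm (v j - h j))\<^sup>2) \<le> e\<^sup>2"
    if "finite F" "\<And>m. m \<ge> N \<Longrightarrow> (\<Sum>j\<in>F. (norm (v j - ell2_seq (X m) j))\<^sup>2) \<le> e\<^sup>2" for F v e N
  proof (rule LIMSEQ_le_const2)
    show "(\<lambda>m. \<Sum>j\<in>F. (norm (v j - ell2_seq (X m) j))\<^sup>2) \<longlonglongrightarrow> (\<Sum>j\<in>F. (norm (v j - h j))\<^sup>2)"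
      by (intro tendsto_intros h)
    show "\<exists>N. \<forall>m\<ge>N. (\<Sum>j\<in>F. (norm (v j - ell2_seq (X m) j))\<^sup>2) \<le> e\<^sup>2"
      using that(2) by blast
  qed
  obtain B where B: "norm (X n) \<le> B" for n
    using X[THEN cauchy_imp_bounded] unfolding bounded_iff by blast
  have "(\<lambda>j. (norm (h j))\<^sup>2) summable_on UNIV"
  proof (rule nonneg_bdd_above_summable_on)
    have "(\<Sum>j\<in>F. (norm (h j))\<^sup>2) \<le> B\<^sup>2" if "finite F" for F
    proof -
      have "(\<Sum>j\<in>F. (norm (ell2_seq (X m) j))\<^sup>2) \<le> B\<^sup>2" for m
        using sum_norm_ell2_seq_le[OF that, of "X m"] power_mono[OF B norm_ge_zero, of m 2]
        by linarith
      then show ?thesis using fatou[OF that, of 0 "\<lambda>_. 0" B] by simp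
    qed
    then show "bdd_above (sum (\<lambda>j. (norm (h j))\<^sup>2) ` {F. F \<subseteq> UNIV \<and> finite F})"
      by (intro bdd_aboveI[where M = "B\<^sup>2"]) blast
  qed simp
  then have L: "ell2_seq (Abs_ell2 h) = h" by (rule ell2_seq_Abs_ell2)
  have "X \<longlonglongrightarrow> Abs_ell2 h"
  proof (rule LIMSEQ_I)
    fix r :: real assume "0 < r"
    then obtain N where N: "\<And>m n. m \<ge> N \<Longrightarrow> n \<ge> N \<Longrightarrow> norm (X m - X n) < r / 2"
      using CauchyD[OF X, of "r / 2"] by auto
    have "norm (X n - Abs_ell2 h) < r" if "n \<ge> N" for n
    proof -
      have "(\<Sum>j\<in>F. (norm (ell2_seq (X n) j - h j))\<^sup>2) \<le> (r / 2)\<^sup>2" if "finite F" for F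
      proof (rule fatou[OF that])
        fix m assume "m \<ge> N"
        then have "(norm (X n - X m))\<^sup>2 \<le> (r / 2)\<^sup>2"
          using N[OF \<open>n \<ge> N\<close>, of m] by (intro power_mono) auto
        then show "(\<Sum>j\<in>F. (norm (ell2_seq (X n) j - ell2_seq (X m) j))\<^sup>2) \<le> (r / 2)\<^sup>2"
          using sum_norm_ell2_seq_le[OF that, of "X n - X m"] by (simp add: ell2_seq_diff)
      qed
      then have "(norm (X n - Abs_ell2 h))\<^sup>2 \<le> (r / 2)\<^sup>2"
        unfolding norm_ell2_power2 using ell2_seq_summable[of "X n - Abs_ell2 h"]
        by (intro infsum_le_finite_sums) (auto simp: ell2_seq_diff L)
      then have "norm (X n - Abs_ell2 h) \<le> r / 2"
        by (rule power2_le_imp_le) (use \<open>0 < r\<close> in simp)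
      then show ?thesis using \<open>0 < r\<close> by simp
    qed
    then show "\<exists>N. \<forall>n\<ge>N. norm (X n - Abs_ell2 h) < r" by blast
  qed
  then show "convergent X" by (rule convergentI)
qed

text \<open>Banach-Steinhaus: by Baire, one of the closed sets \<open>E n\<close> on which all
  operators are bounded by \<open>n\<close> contains a ball, and a ball controls every direction by
  linearity.\<close>

theorem uniform_boundedness:
  fixes T :: "'i \<Rightarrow> 'a::banach \<Rightarrow>\<^sub>L 'b::real_normed_vector"
  assumes bdd: "\<And>x. \<exists>M. \<forall>i\<in>I. norm (T i x) \<le> M"
  shows "\<exists>M. \<forall>i\<in>I. norm (T i) \<le> M"
proof -
  define E where "E n = {x. \<forall>i\<in>I. norm (T i x) \<le> real n}" for n :: nat
  have closed_E: "closed (E n)" for n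
  proof -
    have "E n = (\<Inter>i\<in>I. {x. norm (T i x) \<le> real n})" by (auto simp: E_def)
    moreover have "closed {x. norm (T i x) \<le> real n}" for i
      by (intro closed_Collect_le continuous_intros)
    ultimately show ?thesis by auto
  qed
  have "\<Union> (range E) = UNIV"
  proof -
    have "\<exists>n. x \<in> E n" for x
    proof -
      obtain M where "\<forall>i\<in>I. norm (T i x) \<le> M" using bdd by blast
      then have "x \<in> E (nat \<lceil>M\<rceil>)"
        unfolding E_def using order_trans[OF _ real_nat_ceiling_ge[of M]] by blast
      then show ?thesis ..
    qed
    then show ?thesis by blast
  qed
  moreover have "interior (\<Union> (range E)) = {}" if "\<And>n. interior (E n) = {}"
    using Baire_category_alt[of "euclidean :: 'a topology" "range E"] closed_E that
      completely_metrizable_space_euclidean by auto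
  ultimately have "\<exists>n. interior (E n) \<noteq> {}" by (metis UNIV_not_empty interior_UNIV)
  then obtain n x0 where "x0 \<in> interior (E n)" by blast
  then obtain e where e: "e > 0" "cball x0 e \<subseteq> E n" by (meson mem_interior_cball)
  have "norm (T i) \<le> 2 * real n / e" if i: "i \<in> I" for i
  proof (rule norm_blinfun_bound)
    show "0 \<le> 2 * real n / e" using e by simp
    fix x
    show "norm (T i x) \<le> 2 * real n / e * norm x"
    proof (cases "x = 0")
      case False
      \<comment> \<open>A vector of length exactly \<open>e\<close> along \<open>x\<close>, so that
        it is the difference of two points of \<open>E n\<close>; this produces the factor 2 in the
        bound.\<close>
      define y where "y = (e / norm x) *\<^sub>R x"
      have "norm y = e" using False e by (simp add: y_def)
      then have "x0 + y \<in> E n" "x0 \<in> E n" using e by (auto simp: subset_iff dist_norm)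
      then have "norm (T i (x0 + y) - T i x0) \<le> real n + real n"
        using i by (intro norm_triangle_le_diff add_mono) (auto simp: E_def)
      then have "e / norm x * norm (T i x) \<le> 2 * real n"
        using e by (simp add: y_def blinfun.bilinear_simps)
      then show ?thesis using e False by (simp add: field_simps)
    qed simp
  qed
  then show ?thesis by blast
qed

section \<open>Evolution families\<close>

text \<open>In difference quotient form a derivative is an ordinary limit, to which
  \<open>evolution_tendsto\<close> can be applied.\<close>

lemma has_vector_derivative_iff_Lim:
  "(f has_vector_derivative D) (at x within S) \<longleftrightarrow>
     ((\<lambda>y. (f y - f x) /\<^sub>R (y - x)) \<longlongrightarrow> D) (at x within S)"
proof -
  have "(f has_vector_derivative D) (at x within S) \<longleftrightarrow>
      ((\<lambda>y. norm (f y - f x - (y - x) *\<^sub>R D) / norm (y - x)) \<longlongrightarrow> 0) (at x within S)"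
    by (simp add: has_vector_derivative_def has_derivative_iff_norm bounded_linear_scaleR_left)
  also have "\<dots> \<longleftrightarrow> ((\<lambda>y. norm ((f y - f x) /\<^sub>R (y - x) - D)) \<longlongrightarrow> 0) (at x within S)"
  proof (rule Lim_cong_within[OF refl refl refl])
    fix y assume "y \<noteq> x"
    then have "(f y - f x) /\<^sub>R (y - x) - D = (f y - f x - (y - x) *\<^sub>R D) /\<^sub>R (y - x)"
      by (simp add: scaleR_diff_right)
    then show "norm (f y - f x - (y - x) *\<^sub>R D) / norm (y - x)
        = norm ((f y - f x) /\<^sub>R (y - x) - D)"
      by (simp add: divide_inverse_commute)
  qed
  also have "\<dots> \<longleftrightarrow> ((\<lambda>y. (f y - f x) /\<^sub>R (y - x)) \<longlongrightarrow> D) (at x within S)"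
    by (simp add: tendsto_norm_zero_iff LIM_zero_iff)
  finally show ?thesis .
qed

context
  fixes G :: "real \<Rightarrow> ell2 \<Rightarrow> ell2" and U :: "real \<Rightarrow> real \<Rightarrow> ell2 \<Rightarrow>\<^sub>L ell2"
  assumes gen: "generates_evolution_family G U"
begin

lemma evolution_strongly_continuous: "continuous_on {s..t} (\<lambda>r. U t r w)"
proof -
  have "continuous_on {(t, s). s \<le> t} (\<lambda>(t, s). U t s w)"
    using gen by (simp add: generates_evolution_family_def)
  moreover have "continuous_on {s..t} (\<lambda>r. (t, r))" by (intro continuous_intros)
  ultimately show ?thesis using continuous_on_compose2 by fastforce
qed

text \<open>Strong continuity bounds each orbit on a compact interval, but with a bound that depends
  on the vector; uniform boundedness removes this dependence.\<close>

lemma evolution_locally_bounded: "\<exists>B. \<forall>r\<in>{s..t}. norm (U t r) \<le> B"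
proof (rule uniform_boundedness)
  fix w
  have "bounded ((\<lambda>r. U t r w) ` {s..t})"
    by (intro compact_imp_bounded compact_continuous_image evolution_strongly_continuous) auto
  then show "\<exists>M. \<forall>r\<in>{s..t}. norm (U t r w) \<le> M"
    by (auto simp: bounded_iff)
qed

text \<open>Operator and argument move together. Splitting off \<open>U t r (V r - v)\<close> leaves
  strong continuity at a fixed vector and an error that the local operator bound controls.\<close>

lemma evolution_tendsto:
  assumes s: "s \<in> {s0..t}" and V: "(V \<longlongrightarrow> v) (at s within {s0..t})"
  shows "((\<lambda>r. U t r (V r)) \<longlongrightarrow> U t s v) (at s within {s0..t})"
proof -
  obtain B where B: "\<And>r. r \<in> {s0..t} \<Longrightarrow> norm (U t r) \<le> B"
    using evolution_locally_bounded by blast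
  have "((\<lambda>r. U t r v) \<longlongrightarrow> U t s v) (at s within {s0..t})"
    using s evolution_strongly_continuous by (simp add: continuous_on_def)
  moreover have "((\<lambda>r. U t r (V r - v)) \<longlongrightarrow> 0) (at s within {s0..t})"
  proof (rule Lim_null_comparison)
    show "\<forall>\<^sub>F r in at s within {s0..t}. norm (U t r (V r - v)) \<le> B * norm (V r - v)"
      unfolding eventually_at_filter
    proof (intro always_eventually allI impI)
      fix r assume "r \<in> {s0..t}"
      then show "norm (U t r (V r - v)) \<le> B * norm (V r - v)"
        using order_trans[OF norm_blinfun mult_right_mono[OF B norm_ge_zero]] by blast
    qed
    have "((\<lambda>r. B * norm (V r - v)) \<longlongrightarrow> B * norm (v - v)) (at s within {s0..t})"
      by (intro tendsto_intros V)
    then show "((\<lambda>r. B * norm (V r - v)) \<longlongrightarrow> 0) (at s within {s0..t})" by simp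
  qed
  ultimately have "((\<lambda>r. U t r v + U t r (V r - v)) \<longlongrightarrow> U t s v + 0) (at s within {s0..t})"
    by (rule tendsto_add)
  then show ?thesis by (simp add: blinfun.diff_right)
qed

lemma evolution_continuous_on:
  assumes "continuous_on {s0..t} F"
  shows "continuous_on {s0..t} (\<lambda>s. U t s (F s))"
  using assms unfolding continuous_on_def by (auto intro!: evolution_tendsto)

text \<open>A product rule: the backward equation contributes \<open>- U t s (G s (H s))\<close>,
  which cancels the generator part of the derivative of \<open>H\<close> and leaves only the
  forcing.\<close>

lemma evolution_has_vector_derivative:
  assumes s: "s \<in> {s0..t}"
    and H: "(H has_vector_derivative G s (H s) + f) (at s within {s0..t})"
  shows "((\<lambda>r. U t r (H r)) has_vector_derivative U t s f) (at s within {s0..t})"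
proof -
  have "((\<lambda>r. U t r (H s)) has_vector_derivative - U t s (G s (H s))) (at s within {..t})"
    using gen s by (simp add: generates_evolution_family_def)
  then have "((\<lambda>r. U t r (H s)) has_vector_derivative - U t s (G s (H s))) (at s within {s0..t})"
    by (rule has_vector_derivative_within_subset) auto
  \<comment> \<open>This function vanishes at \<open>r = s\<close>, so its difference quotient is
    \<open>U t r\<close> applied to the difference quotient of \<open>H\<close>.\<close>
  moreover have "((\<lambda>r. U t r (H r - H s)) has_vector_derivative U t s (G s (H s) + f))
      (at s within {s0..t})"
    using evolution_tendsto[OF s H[unfolded has_vector_derivative_iff_Lim]]
    by (simp add: has_vector_derivative_iff_Lim blinfun.scaleR_right)
  ultimately have "((\<lambda>r. U t r (H s) + U t r (H r - H s)) has_vector_derivative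
      - U t s (G s (H s)) + U t s (G s (H s) + f)) (at s within {s0..t})"
    by (rule has_vector_derivative_add)
  then show ?thesis by (simp add: blinfun.add_right blinfun.diff_right)
qed

text \<open>The formula holds for every differentiable solution with zero initial value, so it
  identifies the given solution without a separate uniqueness argument.\<close>

lemma duhamel:
  assumes "s0 \<le> t" "H s0 = 0"
    and H: "\<And>s. s \<in> {s0..t} \<Longrightarrow>
      (H has_vector_derivative G s (H s) + F s) (at s within {s0..t})"
  shows "((\<lambda>s. U t s (F s)) has_integral H t) {s0..t}"
proof -
  have "((\<lambda>s. U t s (F s)) has_integral U t t (H t) - U t s0 (H s0)) {s0..t}"
    using assms evolution_has_vector_derivative[OF _ H]
    by (intro fundamental_theorem_of_calculus) auto
  moreover have "U t t = id_blinfun" using gen by (simp add: generates_evolution_family_def)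
  ultimately show ?thesis using assms by simp
qed

end

section \<open>Exponentially localized sums\<close>

lemma summable_on_shift_int:
  fixes f :: "int \<Rightarrow> 'a::{topological_comm_monoid_add, t2_space}"
  shows "(\<lambda>j. f (j + d)) summable_on UNIV \<longleftrightarrow> f summable_on UNIV"
    and "(\<Sum>\<^sub>\<infinity>j. f (j + d)) = (\<Sum>\<^sub>\<infinity>j. f j)"
proof -
  have bij: "bij_betw (\<lambda>j::int. j + d) UNIV UNIV"
    by (rule bij_betw_byWitness[where f' = "\<lambda>j. j - d"]) auto
  show "(\<lambda>j. f (j + d)) summable_on UNIV \<longleftrightarrow> f summable_on UNIV"
    by (rule summable_on_reindex_bij_betw[OF bij])
  show "(\<Sum>\<^sub>\<infinity>j. f (j + d)) = (\<Sum>\<^sub>\<infinity>j. f j)"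
    by (rule infsum_reindex_bij_betw[OF bij])
qed

lemma summable_exp_int:
  fixes \<gamma> :: real
  assumes "0 < \<gamma>"
  shows "(\<lambda>j::int. exp (- \<gamma> * \<bar>of_int j\<bar>) ) summable_on UNIV"
proof -
  have geo: "(\<lambda>n::nat. exp (- \<gamma> * real n)) summable_on UNIV"
  proof -
    have "summable (\<lambda>n. (exp (- \<gamma>)) ^ n)"
      using assms by (intro summable_geometric) simp
    then have "summable (\<lambda>n::nat. exp (- \<gamma> * real n))"
      by (simp add: exp_of_nat_mult[symmetric] mult.commute)
    then show ?thesis by (simp add: summable_on_UNIV_nonneg_real_iff)
  qed
  have "(\<lambda>j::int. exp (- \<gamma> * \<bar>of_int j\<bar>)) summable_on range int"
    using geo by (subst summable_on_reindex) (auto simp: o_def)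
  moreover have "(\<lambda>j::int. exp (- \<gamma> * \<bar>of_int j\<bar>)) summable_on range (\<lambda>n. - int n)"
    using geo by (subst summable_on_reindex) (auto simp: o_def inj_on_def)
  ultimately have "(\<lambda>j::int. exp (- \<gamma> * \<bar>of_int j\<bar>)) summable_on
      (range int \<union> range (\<lambda>n. - int n))"
    by (rule summable_on_union)
  moreover have "range int \<union> range (\<lambda>n. - int n) = UNIV"
  proof -
    have "j \<in> range int \<union> range (\<lambda>n. - int n)" for j by (cases j rule: int_cases2) auto
    then show ?thesis by blast
  qed
  ultimately show ?thesis by simp
qed

text \<open>Rounding \<open>\<xi>\<close> to an integer costs the factor
  \<open>exp \<gamma>\<close>. After an integer shift lattice sums are translation invariant, which
  makes the later bounds uniform in \<open>\<xi>\<close>.\<close>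

lemma exp_int_shift_le:
  fixes \<gamma> \<xi> :: real
  assumes "0 \<le> \<gamma>"
  shows "exp (- \<gamma> * \<bar>of_int j - \<xi>\<bar>) \<le> exp \<gamma> * exp (- \<gamma> * \<bar>of_int (j + - \<lfloor>\<xi>\<rfloor>)\<bar>)"
proof -
  have "\<bar>of_int (j + - \<lfloor>\<xi>\<rfloor>)\<bar> \<le> 1 + \<bar>of_int j - \<xi>\<bar>" by simp linarith
  from mult_left_mono[OF this assms] show ?thesis unfolding mult_exp_exp
    by (simp add: algebra_simps)
qed

lemma summable_exp_int_shift:
  fixes \<gamma> \<xi> :: real
  assumes "0 < \<gamma>"
  shows "(\<lambda>j::int. exp (- \<gamma> * \<bar>of_int j - \<xi>\<bar>)) summable_on UNIV"
proof (rule summable_on_comparison_test)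
  show "(\<lambda>j::int. exp \<gamma> * exp (- \<gamma> * \<bar>of_int (j + - \<lfloor>\<xi>\<rfloor>)\<bar>)) summable_on UNIV"
    by (intro summable_on_cmult_right
      iffD2[OF summable_on_shift_int(1)[of "\<lambda>j. exp (- \<gamma> * \<bar>of_int j\<bar>)"]]
      summable_exp_int assms)
qed (use assms exp_int_shift_le[of \<gamma>] in auto)

lemma summable_exp_int_shift_square:
  fixes \<gamma> \<xi> C :: real
  assumes "0 < \<gamma>"
  shows "(\<lambda>j::int. (C * exp (- \<gamma> * \<bar>of_int j - \<xi>\<bar>))\<^sup>2) summable_on UNIV"
proof -
  have "(\<lambda>j::int. C\<^sup>2 * exp (- (2 * \<gamma>) * \<bar>of_int j - \<xi>\<bar>)) summable_on UNIV"
    using assms by (intro summable_on_cmult_right summable_exp_int_shift) simp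
  then show ?thesis by (simp add: power_mult_distrib exp_double[symmetric] mult.assoc)
qed

lemma infsum_exp_int_shift_le:
  fixes \<gamma> \<xi> :: real
  assumes "0 < \<gamma>"
  shows "(\<Sum>\<^sub>\<infinity>j::int. exp (- \<gamma> * \<bar>of_int j - \<xi>\<bar>))
    \<le> exp \<gamma> * (\<Sum>\<^sub>\<infinity>j::int. exp (- \<gamma> * \<bar>of_int j\<bar>))"
proof -
  have "(\<Sum>\<^sub>\<infinity>j::int. exp (- \<gamma> * \<bar>of_int j - \<xi>\<bar>))
      \<le> (\<Sum>\<^sub>\<infinity>j::int. exp \<gamma> * exp (- \<gamma> * \<bar>of_int (j + - \<lfloor>\<xi>\<rfloor>)\<bar>))"
    using assms
    by (intro infsum_mono summable_exp_int_shift summable_on_cmult_right exp_int_shift_le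
      iffD2[OF summable_on_shift_int(1)[of "\<lambda>j. exp (- \<gamma> * \<bar>of_int j\<bar>)"]]
      summable_exp_int) auto
  also have "\<dots> = exp \<gamma> * (\<Sum>\<^sub>\<infinity>j::int. exp (- \<gamma> * \<bar>of_int j\<bar>))"
    by (simp only: infsum_cmult_right'
      summable_on_shift_int(2)[of "\<lambda>j. exp (- \<gamma> * \<bar>of_int j\<bar>)"])
  finally show ?thesis .
qed

text \<open>Replaces all centres in a bounded set by a single centre, giving one majorant for a
  whole convergent sequence of wave positions.\<close>

lemma exp_decay_translate_le:
  fixes \<gamma> x \<xi> \<rho> :: real
  assumes "0 \<le> \<gamma>" "\<bar>\<xi>\<bar> \<le> \<rho>"
  shows "exp (- \<gamma> * \<bar>x - \<xi>\<bar>) \<le> exp (\<gamma> * \<rho>) * exp (- \<gamma> * \<bar>x\<bar>)"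
proof -
  have "\<bar>x\<bar> \<le> \<rho> + \<bar>x - \<xi>\<bar>" using assms by linarith
  from mult_left_mono[OF this assms(1)] show ?thesis unfolding mult_exp_exp
    by (simp add: algebra_simps)
qed

lemma convergent_bounded_by:
  fixes \<xi> :: "nat \<Rightarrow> real"
  assumes "\<xi> \<longlonglongrightarrow> l"
  obtains \<rho> where "\<And>n. \<bar>\<xi> n\<bar> \<le> \<rho>"
  using convergent_imp_Bseq[OF convergentI[OF assms]] unfolding Bseq_def by auto

text \<open>Decay of \<open>q\<close> controls the tails, so boundedness and coordinatewise
  convergence of the sequence suffice. The first bound does not depend on the position
  \<open>\<xi>\<close>.\<close>

lemma
  fixes q :: "real \<Rightarrow> real"
  assumes "0 < \<beta>" and q: "\<And>x. \<bar>q x\<bar> \<le> C * exp (- \<beta> * \<bar>x\<bar>)"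
  shows infsum_localized_le: "\<And>\<xi>. \<forall>j. \<bar>f j\<bar> \<le> B \<Longrightarrow> \<bar>\<Sum>\<^sub>\<infinity>j::int. q (of_int j - \<xi>) * f j\<bar>
      \<le> C * B * (exp \<beta> * (\<Sum>\<^sub>\<infinity>j::int. exp (- \<beta> * \<bar>of_int j\<bar>)))"
    and tendsto_infsum_localized: "\<And>\<xi> \<xi>' F f. continuous_on UNIV q \<Longrightarrow> \<xi>' \<longlonglongrightarrow> \<xi> \<Longrightarrow>
      (\<And>j. (\<lambda>n. F n j) \<longlonglongrightarrow> f j) \<Longrightarrow> (\<And>n j. \<bar>F n j\<bar> \<le> B) \<Longrightarrow>
      (\<lambda>n. \<Sum>\<^sub>\<infinity>j::int. q (of_int j - \<xi>' n) * F n j) \<longlonglongrightarrow> (\<Sum>\<^sub>\<infinity>j. q (of_int j - \<xi>) * f j)"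
proof -
  have C: "0 \<le> C" using order_trans[OF abs_ge_zero q[of 0]] by simp
  have le: "\<bar>q (of_int j - \<xi>) * y\<bar> \<le> C * B * exp (- \<beta> * \<bar>of_int j - \<xi>\<bar>)"
    if "\<bar>y\<bar> \<le> B" for j :: int and \<xi> y
    using mult_mono[OF q that] C by (simp add: abs_mult mult.assoc mult.left_commute mult.commute)
  {
    fix \<xi> and f :: "int \<Rightarrow> real" assume f: "\<forall>j. \<bar>f j\<bar> \<le> B"
    have sum: "(\<lambda>j::int. C * B * exp (- \<beta> * \<bar>of_int j - \<xi>\<bar>)) summable_on UNIV"
      by (intro summable_on_cmult_right summable_exp_int_shift assms(1))
    have abs: "(\<lambda>j::int. \<bar>q (of_int j - \<xi>) * f j\<bar>) summable_on UNIV"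
      by (rule summable_on_comparison_test[OF sum]) (use f le in auto)
    have "\<bar>\<Sum>\<^sub>\<infinity>j::int. q (of_int j - \<xi>) * f j\<bar> \<le> (\<Sum>\<^sub>\<infinity>j::int. \<bar>q (of_int j - \<xi>) * f j\<bar>)"
      using norm_infsum_bound[of "\<lambda>j::int. q (of_int j - \<xi>) * f j" UNIV] abs by simp
    also have "\<dots> \<le> (\<Sum>\<^sub>\<infinity>j::int. C * B * exp (- \<beta> * \<bar>of_int j - \<xi>\<bar>))"
      by (rule infsum_mono[OF abs sum]) (use f le in auto)
    also have "\<dots> = C * B * (\<Sum>\<^sub>\<infinity>j::int. exp (- \<beta> * \<bar>of_int j - \<xi>\<bar>))"
      by (rule infsum_cmult_right')
    also have "\<dots> \<le> C * B * (exp \<beta> * (\<Sum>\<^sub>\<infinity>j::int. exp (- \<beta> * \<bar>of_int j\<bar>)))"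
      using C order_trans[OF abs_ge_zero f[rule_format, of 0]]
      by (intro mult_left_mono infsum_exp_int_shift_le assms(1)) auto
    finally show "\<bar>\<Sum>\<^sub>\<infinity>j::int. q (of_int j - \<xi>) * f j\<bar>
      \<le> C * B * (exp \<beta> * (\<Sum>\<^sub>\<infinity>j::int. exp (- \<beta> * \<bar>of_int j\<bar>)))" .
  }
  fix \<xi> and \<xi>' :: "nat \<Rightarrow> real" and F and f :: "int \<Rightarrow> real"
  assume qc: "continuous_on UNIV q" and \<xi>: "\<xi>' \<longlonglongrightarrow> \<xi>"
    and F: "\<And>j. (\<lambda>n. F n j) \<longlonglongrightarrow> f j" "\<And>n j. \<bar>F n j\<bar> \<le> B"
  obtain \<rho> where \<rho>: "\<And>n. \<bar>\<xi>' n\<bar> \<le> \<rho>" using \<xi> by (rule convergent_bounded_by) blast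
  have B: "0 \<le> B" using F(2)[of 0 0] by linarith
  show "(\<lambda>n. \<Sum>\<^sub>\<infinity>j::int. q (of_int j - \<xi>' n) * F n j) \<longlonglongrightarrow> (\<Sum>\<^sub>\<infinity>j. q (of_int j - \<xi>) * f j)"
  proof (rule tendsto_infsum_dominated)
    show "(\<lambda>j::int. C * B * (exp (\<beta> * \<rho>) * exp (- \<beta> * \<bar>of_int j\<bar>))) summable_on UNIV"
      by (intro summable_on_cmult_right summable_exp_int assms(1))
    show "\<bar>q (of_int j - \<xi>' n) * F n j\<bar> \<le> C * B * (exp (\<beta> * \<rho>) * exp (- \<beta> * \<bar>of_int j\<bar>))" for n j
      using order_trans[OF le[OF F(2)] mult_left_mono[OF exp_decay_translate_le[OF _ \<rho>]]]
        assms(1) C B by simp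
    show "(\<lambda>n. q (of_int j - \<xi>' n) * F n j) \<longlonglongrightarrow> q (of_int j - \<xi>) * f j" for j
      using qc by (intro tendsto_mult F continuous_on_tendsto_compose[OF qc] tendsto_intros \<xi>) auto
  qed
qed

section \<open>The symplectic form and the forcing\<close>

lemma abs_summable_vec_nth:
  fixes f :: "int \<Rightarrow> real^2"
  assumes "(\<lambda>j. norm (f j)) summable_on UNIV"
  shows "(\<lambda>j. \<bar>f j $ k\<bar>) summable_on UNIV"
  by (rule summable_on_comparison_test[OF assms]) (auto simp: component_le_norm_cart)

lemma inner_vec2: "(x :: real^2) \<bullet> y = x $ 1 * y $ 1 + x $ 2 * y $ 2"
  by (simp add: inner_vec_def sum_2)

lemma norm_vector2_le: "norm (vector [x, y] :: real^2) \<le> \<bar>x\<bar> + \<bar>y\<bar>"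
  using norm_le_l1_cart[of "vector [x, y] :: real^2"] by (simp add: sum_2)

lemma abs_summable_on_translate:
  fixes f :: "int \<Rightarrow> real"
  assumes "(\<lambda>j. \<bar>f j\<bar>) summable_on UNIV"
  shows "(\<lambda>d. f (j + d)) summable_on S"
proof -
  have "(\<lambda>d. \<bar>f (d + j)\<bar>) summable_on UNIV"
    using summable_on_shift_int(1)[of "\<lambda>i. \<bar>f i\<bar>" j] assms by simp
  then have "(\<lambda>d. f (d + j)) summable_on UNIV"
    by (simp add: summable_on_iff_abs_summable_on_real[of "\<lambda>d. f (d + j)"])
  then have "(\<lambda>d. f (j + d)) summable_on UNIV" by (simp add: add.commute)
  then show ?thesis by (rule summable_on_subset_banach) auto
qed

lemma abs_infsum_translate_le:
  fixes f :: "int \<Rightarrow> real"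
  assumes "(\<lambda>j. \<bar>f j\<bar>) summable_on UNIV"
  shows "\<bar>\<Sum>\<^sub>\<infinity>d\<in>S. f (j + d)\<bar> \<le> (\<Sum>\<^sub>\<infinity>i. \<bar>f i\<bar>)"
proof -
  have abs: "(\<lambda>d. \<bar>f (j + d)\<bar>) summable_on T" for T
    using abs_summable_on_translate[of "\<lambda>i. \<bar>f i\<bar>" j T] assms by simp
  have "\<bar>\<Sum>\<^sub>\<infinity>d\<in>S. f (j + d)\<bar> \<le> (\<Sum>\<^sub>\<infinity>d\<in>S. \<bar>f (j + d)\<bar>)"
    using norm_infsum_bound[of "\<lambda>d. f (j + d)" S] abs by simp
  also have "\<dots> \<le> (\<Sum>\<^sub>\<infinity>d. \<bar>f (j + d)\<bar>)"
    by (rule infsum_mono_neutral[OF abs abs]) auto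
  also have "\<dots> = (\<Sum>\<^sub>\<infinity>i. \<bar>f i\<bar>)"
    using summable_on_shift_int(2)[of "\<lambda>i. \<bar>f i\<bar>" j] by (simp add: add.commute)
  finally show ?thesis .
qed

lemma infsum_diff_real:
  fixes f g :: "'i \<Rightarrow> real"
  assumes "f summable_on S" "g summable_on S"
  shows "infsum (\<lambda>x. f x - g x) S = infsum f S - infsum g S"
  using infsum_add[of f S "\<lambda>x. - g x"] assms by (simp add: infsum_uminus summable_on_uminus)

lemma fdiff_fdiff_inv:
  assumes "(\<lambda>j. \<bar>f j\<bar>) summable_on UNIV"
  shows "fdiff_inv f (j + 1) = fdiff_inv f j + f j"
proof -
  have bij: "bij_betw (\<lambda>d::int. d + 1) {..-1} {..0}"
    by (rule bij_betw_byWitness[where f' = "\<lambda>d. d - 1"]) auto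
  have "fdiff_inv f (j + 1) = (\<Sum>\<^sub>\<infinity>d\<in>{..-1}. f (j + (d + 1)))"
    by (simp add: fdiff_inv_def add.commute add.left_commute)
  also have "\<dots> = (\<Sum>\<^sub>\<infinity>d\<in>{..0}. f (j + d))"
    by (rule infsum_reindex_bij_betw[OF bij, of "\<lambda>d. f (j + d)"])
  also have "{..0::int} = insert 0 {..-1}" by auto
  also have "(\<Sum>\<^sub>\<infinity>d\<in>insert 0 {..-1}. f (j + d)) = f j + (\<Sum>\<^sub>\<infinity>d\<in>{..-1}. f (j + d))"
    by (subst infsum_insert) (use abs_summable_on_translate[OF assms] in auto)
  finally show ?thesis by (simp add: fdiff_inv_def)
qed

context
  fixes f :: "int \<Rightarrow> real^2"
  assumes f: "(\<lambda>j. norm (f j)) summable_on UNIV"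
begin

text \<open>One-sided summation turns summable into merely bounded, so convergence of the symplectic
  pairing has to come from the second argument.\<close>

lemma norm_J_inv_le: "norm (J_inv f j) \<le> (\<Sum>\<^sub>\<infinity>i. \<bar>f i $ 2\<bar>) + (\<Sum>\<^sub>\<infinity>i. \<bar>f i $ 1\<bar>)"
  unfolding J_inv_def bdiff_inv_def fdiff_inv_def
  by (intro order_trans[OF norm_vector2_le] add_mono abs_infsum_translate_le
      abs_summable_vec_nth f)

lemma J_inv_inner_summable:
  assumes g: "(\<lambda>j. norm (g j)) summable_on UNIV"
  shows "(\<lambda>j. J_inv f j \<bullet> g j) summable_on UNIV"
proof (rule abs_summable_summable, rule summable_on_comparison_test)
  show "(\<lambda>j. ((\<Sum>\<^sub>\<infinity>i. \<bar>f i $ 2\<bar>) + (\<Sum>\<^sub>\<infinity>i. \<bar>f i $ 1\<bar>)) * norm (g j)) summable_on UNIV"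
    by (intro summable_on_cmult_right g)
  show "norm (J_inv f j \<bullet> g j) \<le> ((\<Sum>\<^sub>\<infinity>i. \<bar>f i $ 2\<bar>) + (\<Sum>\<^sub>\<infinity>i. \<bar>f i $ 1\<bar>)) * norm (g j)" for j
    unfolding real_norm_def
    by (rule order_trans[OF Cauchy_Schwarz_ineq2 mult_right_mono[OF norm_J_inv_le norm_ge_zero]])
qed auto

lemma \<Omega>_lincomb:
  assumes "(\<lambda>j. norm (g j)) summable_on UNIV" "(\<lambda>j. norm (h j)) summable_on UNIV"
    "(\<lambda>j. norm (k j)) summable_on UNIV"
  shows "\<Omega> f (\<lambda>j. - x *\<^sub>R g j - y *\<^sub>R h j + k j) = - x * \<Omega> f g - y * \<Omega> f h + \<Omega> f k"
proof -
  note s = J_inv_inner_summable[OF assms(1)] J_inv_inner_summable[OF assms(2)]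
    J_inv_inner_summable[OF assms(3)]
  have "\<Omega> f (\<lambda>j. - x *\<^sub>R g j - y *\<^sub>R h j + k j)
      = (\<Sum>\<^sub>\<infinity>j. - x * (J_inv f j \<bullet> g j) + - y * (J_inv f j \<bullet> h j) + J_inv f j \<bullet> k j)"
    unfolding \<Omega>_def by (simp add: inner_add_right inner_diff_right)
  also have "\<dots> = - x * \<Omega> f g + - y * \<Omega> f h + \<Omega> f k"
    unfolding \<Omega>_def using s
    by (simp only: infsum_add summable_on_add summable_on_cmult_right infsum_cmult_right')
  finally show ?thesis by simp
qed

text \<open>Summation by parts: only the second component of \<open>J_inv f\<close> meets the
  vector, and its forward difference is the first component of \<open>f\<close>.\<close>

lemma \<Omega>_bdiff:
  fixes h :: "int \<Rightarrow> real"
  assumes h: "(\<lambda>j. \<bar>h j\<bar>) summable_on UNIV"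
  shows "\<Omega> f (\<lambda>j. vector [0, bdiff h j]) = - (\<Sum>\<^sub>\<infinity>j. f j $ 1 * h j)"
proof -
  define P where "P = fdiff_inv (\<lambda>i. f i $ 1)"
  note f1 = abs_summable_vec_nth[OF f, of 1]
  have step: "P (j + 1) = P j + f j $ 1" for j
    unfolding P_def by (rule fdiff_fdiff_inv[OF f1])
  have P_le: "\<bar>P j\<bar> \<le> (\<Sum>\<^sub>\<infinity>i. \<bar>f i $ 1\<bar>)" for j
    unfolding P_def fdiff_inv_def by (rule abs_infsum_translate_le[OF f1])
  \<comment> \<open>Needed for \<open>d = 0\<close> and \<open>d = 1\<close>, the two sums that the
    shift by one site below produces.\<close>
  have Ph: "(\<lambda>j. P (j + d) * h j) summable_on UNIV" for d
  proof (rule abs_summable_summable, rule summable_on_comparison_test)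
    show "(\<lambda>j. (\<Sum>\<^sub>\<infinity>i. \<bar>f i $ 1\<bar>) * \<bar>h j\<bar>) summable_on UNIV"
      by (intro summable_on_cmult_right h)
    show "norm (P (j + d) * h j) \<le> (\<Sum>\<^sub>\<infinity>i. \<bar>f i $ 1\<bar>) * \<bar>h j\<bar>" for j
      using mult_right_mono[OF P_le abs_ge_zero] by (simp add: abs_mult)
  qed auto
  have Ph0: "(\<lambda>j. P j * h j) summable_on UNIV" using Ph[of 0] by simp
  have Ph1: "(\<lambda>j. P j * h (j - 1)) summable_on UNIV"
    using Ph[of 1] summable_on_shift_int(1)[of "\<lambda>j. P j * h (j - 1)" 1] by simp
  have "\<Omega> f (\<lambda>j. vector [0, bdiff h j]) = (\<Sum>\<^sub>\<infinity>j. P j * h j - P j * h (j - 1))"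
    by (simp add: \<Omega>_def inner_vec2 J_inv_def P_def bdiff_def algebra_simps)
  also have "\<dots> = (\<Sum>\<^sub>\<infinity>j. P j * h j) - (\<Sum>\<^sub>\<infinity>j. P j * h (j - 1))"
    by (rule infsum_diff_real[OF Ph0 Ph1])
  also have "(\<Sum>\<^sub>\<infinity>j. P j * h (j - 1)) = (\<Sum>\<^sub>\<infinity>j. P (j + 1) * h j)"
    using summable_on_shift_int(2)[of "\<lambda>j. P j * h (j - 1)" 1] by simp
  also have "(\<Sum>\<^sub>\<infinity>j. P j * h j) - (\<Sum>\<^sub>\<infinity>j. P (j + 1) * h j)
      = (\<Sum>\<^sub>\<infinity>j. P j * h j - P (j + 1) * h j)"
    by (rule infsum_diff_real[OF Ph0 Ph, symmetric])
  also have "\<dots> = (\<Sum>\<^sub>\<infinity>j. - (f j $ 1 * h j))"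
    by (simp add: step algebra_simps)
  finally show ?thesis by (simp add: infsum_uminus)
qed

end

lemma deriv_square_component:
  fixes g :: "real \<Rightarrow> real^2"
  assumes "(g has_vector_derivative D) (at x)"
  shows "deriv (\<lambda>y. (g y $ 1)\<^sup>2) x = 2 * g x $ 1 * D $ 1"
proof -
  have "((\<lambda>y. g y $ 1) has_real_derivative D $ 1) (at x)"
    using bounded_linear.has_vector_derivative[OF bounded_linear_vec_nth assms]
    by (simp add: has_real_derivative_iff_has_vector_derivative)
  then have "((\<lambda>y. (g y $ 1)\<^sup>2) has_real_derivative 2 * g x $ 1 * D $ 1) (at x)"
    by (auto intro!: derivative_eq_intros)
  then show ?thesis by (rule DERIV_imp_deriv)
qed

section \<open>The wave, its modulation and the forcing at one fixed speed\<close>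

locale solitary_wave =
  fixes \<phi> :: "real \<Rightarrow> real \<Rightarrow> real^2" and c :: real and \<phi>\<^sub>x \<phi>\<^sub>c :: "real \<Rightarrow> real^2" and \<beta> K :: real
  assumes \<beta>: "0 < \<beta>"
    and deriv_x: "\<And>x. (\<phi> c has_vector_derivative \<phi>\<^sub>x x) (at x)"
    and deriv_c: "\<And>x. ((\<lambda>c'. \<phi> c' x) has_vector_derivative \<phi>\<^sub>c x) (at c)"
    and cont_x: "continuous_on UNIV \<phi>\<^sub>x" and cont_c: "continuous_on UNIV \<phi>\<^sub>c"
    and decay: "\<And>x. norm (\<phi> c x) \<le> K * exp (- \<beta> * \<bar>x\<bar>)"
    and decay_x: "\<And>x. norm (\<phi>\<^sub>x x) \<le> K * exp (- \<beta> * \<bar>x\<bar>)"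
    and decay_c: "\<And>x. norm (\<phi>\<^sub>c x) \<le> K * exp (- \<beta> * \<bar>x\<bar>)"
    and gram: "\<And>\<xi>. vector
         [vector [\<Omega> (d_xi \<phi> \<xi> c) (d_xi \<phi> \<xi> c), \<Omega> (d_xi \<phi> \<xi> c) (d_c \<phi> \<xi> c)],
          vector [\<Omega> (d_c \<phi> \<xi> c) (d_xi \<phi> \<xi> c), \<Omega> (d_c \<phi> \<xi> c) (d_c \<phi> \<xi> c)]]
       = A_mat \<phi> c"
    and \<alpha>\<^sub>0_pos: "0 < \<alpha>\<^sub>0 \<phi> c"
begin

lemma cont: "continuous_on UNIV (\<phi> c)"
  using deriv_x by (auto intro!: continuous_at_imp_continuous_on has_vector_derivative_continuous)

lemma K_nonneg: "0 \<le> K" using order_trans[OF norm_ge_zero decay[of 0]] by simp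

lemma wave_has_vector_derivative_xi:
  "((\<lambda>\<xi>'. wave \<phi> \<xi>' c j) has_vector_derivative - \<phi>\<^sub>x (of_int j - \<xi>)) (at \<xi>)"
proof -
  have "((\<lambda>\<xi>'. of_int j - \<xi>') has_vector_derivative (-1)) (at \<xi>)"
    by (auto intro!: derivative_eq_intros)
  from vector_diff_chain_at[OF this deriv_x] show ?thesis by (simp add: wave_def o_def)
qed

lemma wave_has_vector_derivative_c:
  "((\<lambda>c'. wave \<phi> \<xi> c' j) has_vector_derivative \<phi>\<^sub>c (of_int j - \<xi>)) (at c)"
  unfolding wave_def by (rule deriv_c)

lemma d_xi_eq: "d_xi \<phi> \<xi> c j = - \<phi>\<^sub>x (of_int j - \<xi>)"
  unfolding d_xi_def by (rule vector_derivative_at[OF wave_has_vector_derivative_xi])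

lemma d_c_eq: "d_c \<phi> \<xi> c j = \<phi>\<^sub>c (of_int j - \<xi>)"
  unfolding d_c_def by (rule vector_derivative_at[OF wave_has_vector_derivative_c])

text \<open>The profiles of the derivatives of the squared first component in position and in speed.
  As functions of one variable they turn the pairings into sums of
  \<open>q (of_int j - \<xi>) * f j\<close>. The minus sign comes from differentiating in the
  position.\<close>

definition q_xi where "q_xi x = - 2 * \<phi> c x $ 1 * \<phi>\<^sub>x x $ 1"
definition q_c where "q_c x = 2 * \<phi> c x $ 1 * \<phi>\<^sub>c x $ 1"

text \<open>A bound, uniform in the centre, for the lattice sum of an exponential of rate
  \<open>\<beta>\<close>.\<close>

definition E :: real where "E = exp \<beta> * (\<Sum>\<^sub>\<infinity>j::int. exp (- \<beta> * \<bar>of_int j\<bar>))"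

lemma modulation_eq:
  "modulation \<phi> \<xi> c f = (- 1/2) *\<^sub>R (matrix_inv (A_mat \<phi> c) *v vector
     [\<Sum>\<^sub>\<infinity>j. q_xi (of_int j - \<xi>) * f j, \<Sum>\<^sub>\<infinity>j. q_c (of_int j - \<xi>) * f j])"
  unfolding modulation_def deriv_square_component[OF wave_has_vector_derivative_xi]
    deriv_square_component[OF wave_has_vector_derivative_c]
  by (simp add: wave_def q_xi_def q_c_def)

lemma forcing_eq:
  "forcing \<phi> \<xi> c f j = (modulation \<phi> \<xi> c f $ 1) *\<^sub>R \<phi>\<^sub>x (of_int j - \<xi>)
     - (modulation \<phi> \<xi> c f $ 2) *\<^sub>R \<phi>\<^sub>c (of_int j - \<xi>)
     + vector [0, f j * \<phi> c (of_int j - \<xi>) $ 1 - f (j - 1) * \<phi> c (of_int j - \<xi> - 1) $ 1]"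
  by (simp add: forcing_def d_xi_eq d_c_eq bdiff_def wave_def algebra_simps)

lemma product_decay:
  assumes "\<And>x. norm (g x) \<le> K * exp (- \<beta> * \<bar>x\<bar>)"
  shows "\<bar>2 * \<phi> c x $ 1 * (g x :: real^2) $ 1\<bar> \<le> 2 * K\<^sup>2 * exp (- \<beta> * \<bar>x\<bar>)"
proof -
  have "K * exp (- \<beta> * \<bar>x\<bar>) \<le> K * 1"
    using K_nonneg \<beta> by (intro mult_left_mono) auto
  then have "\<bar>\<phi> c x $ 1\<bar> \<le> K"
    using component_le_norm_cart[of "\<phi> c x" 1] decay[of x] by linarith
  moreover have "\<bar>g x $ 1\<bar> \<le> K * exp (- \<beta> * \<bar>x\<bar>)"
    using component_le_norm_cart[of "g x" 1] assms[of x] by linarith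
  ultimately have "\<bar>\<phi> c x $ 1\<bar> * \<bar>g x $ 1\<bar> \<le> K * (K * exp (- \<beta> * \<bar>x\<bar>))"
    using K_nonneg by (intro mult_mono) auto
  then show ?thesis by (simp add: abs_mult power2_eq_square)
qed

lemma q_decay:
  "\<bar>q_xi x\<bar> \<le> 2 * K\<^sup>2 * exp (- \<beta> * \<bar>x\<bar>)" "\<bar>q_c x\<bar> \<le> 2 * K\<^sup>2 * exp (- \<beta> * \<bar>x\<bar>)"
  using product_decay[OF decay_x, of x] product_decay[OF decay_c, of x]
  by (simp_all add: q_xi_def q_c_def abs_mult)

lemma q_cont: "continuous_on UNIV q_xi" "continuous_on UNIV q_c"
  unfolding q_xi_def q_c_def by (intro continuous_intros cont cont_x cont_c)+

text \<open>The bound is uniform in the position because \<open>A_mat\<close> depends on the speed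
  alone and the two pairings are bounded independently of \<open>\<xi>\<close>.\<close>

lemma modulation_bounded:
  "\<exists>C. \<forall>\<xi> f. (\<forall>j. \<bar>f j\<bar> \<le> B) \<longrightarrow> norm (modulation \<phi> \<xi> c f) \<le> C"
proof -
  let ?L = "onorm ((*v) (matrix_inv (A_mat \<phi> c)))"
  define S where "S = 2 * K\<^sup>2 * B * E"
  have "norm (modulation \<phi> \<xi> c f) \<le> ?L * (2 * S)" if "\<forall>j. \<bar>f j\<bar> \<le> B" for \<xi> f
  proof -
    let ?s = "\<lambda>q. \<Sum>\<^sub>\<infinity>j::int. q (of_int j - \<xi>) * f j"
    have "\<bar>?s q_xi\<bar> \<le> S" "\<bar>?s q_c\<bar> \<le> S"
      unfolding S_def E_def by (rule infsum_localized_le[OF \<beta> q_decay(1) that] infsum_localized_le[OF \<beta> q_decay(2) that])+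
    then have "norm (vector [?s q_xi, ?s q_c] :: real^2) \<le> 2 * S"
      using norm_vector2_le[of "?s q_xi" "?s q_c"] by linarith
    then have Ls: "norm (matrix_inv (A_mat \<phi> c) *v vector [?s q_xi, ?s q_c]) \<le> ?L * (2 * S)"
      using onorm[OF matrix_vector_mul_bounded_linear] order_trans
        mult_left_mono[OF _ onorm_pos_le[OF matrix_vector_mul_bounded_linear]] by blast
    show ?thesis
      unfolding modulation_eq norm_scaleR
      by (rule order_trans[OF mult_left_le_one_le Ls]) auto
  qed
  then show ?thesis by blast
qed

lemma forcing_decay:
  "\<exists>C\<ge>0. \<forall>\<xi> f j. (\<forall>i. \<bar>f i\<bar> \<le> B) \<longrightarrow>
     norm (forcing \<phi> \<xi> c f j) \<le> C * exp (- \<beta> * \<bar>of_int j - \<xi>\<bar>)"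
proof (cases "0 \<le> B")
  case B: True
  obtain C where C: "\<And>\<xi> f. \<forall>j. \<bar>f j\<bar> \<le> B \<Longrightarrow> norm (modulation \<phi> \<xi> c f) \<le> C"
    using modulation_bounded by blast
  have C0: "0 \<le> C" using order_trans[OF norm_ge_zero C[of "\<lambda>_. 0"]] B by simp
  have "norm (forcing \<phi> \<xi> c f j) \<le> (C * K + C * K + B * K * (1 + exp \<beta>)) * exp (- \<beta> * \<bar>of_int j - \<xi>\<bar>)"
    if f: "\<forall>i. \<bar>f i\<bar> \<le> B" for \<xi> f j
  proof -
    let ?m = "modulation \<phi> \<xi> c f" and ?x = "of_int j - \<xi>"
    let ?e = "exp (- \<beta> * \<bar>?x\<bar>)"
    have m: "\<bar>?m $ k\<bar> \<le> C" for k using component_le_norm_cart[of ?m k] C[OF f, of \<xi>] by linarith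
    have 1: "norm ((?m $ 1) *\<^sub>R \<phi>\<^sub>x ?x) \<le> C * (K * ?e)" "norm ((?m $ 2) *\<^sub>R \<phi>\<^sub>c ?x) \<le> C * (K * ?e)"
      unfolding norm_scaleR using C0 by (intro mult_mono m decay_x decay_c; simp)+
    have r: "\<bar>f i * \<phi> c y $ 1\<bar> \<le> B * (K * exp (- \<beta> * \<bar>y\<bar>))" for i y
      unfolding abs_mult using f B
      by (intro mult_mono order_trans[OF component_le_norm_cart decay]) auto
    \<comment> \<open>The backward difference evaluates the profile one site to the left; this is
      the origin of the \<open>exp \<beta>\<close> in the constant.\<close>
    have "exp (- \<beta> * \<bar>?x - 1\<bar>) \<le> exp (\<beta> * 1) * ?e"
      using \<beta> by (intro exp_decay_translate_le) auto
    then have "B * (K * exp (- \<beta> * \<bar>?x - 1\<bar>)) \<le> B * (K * (exp \<beta> * ?e))"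
      using B K_nonneg by (intro mult_left_mono) auto
    then have "\<bar>f (j - 1) * \<phi> c (?x - 1) $ 1\<bar> \<le> B * (K * (exp \<beta> * ?e))"
      using r[of "j - 1" "?x - 1"] by linarith
    then have "norm (vector [0, f j * \<phi> c ?x $ 1 - f (j - 1) * \<phi> c (?x - 1) $ 1] :: real^2)
        \<le> B * (K * ?e) + B * (K * (exp \<beta> * ?e))"
      using norm_vector2_le[of 0 "f j * \<phi> c ?x $ 1 - f (j - 1) * \<phi> c (?x - 1) $ 1"]
        r[of j ?x] by linarith
    then have "norm (forcing \<phi> \<xi> c f j)
        \<le> C * (K * ?e) + C * (K * ?e) + (B * (K * ?e) + B * (K * (exp \<beta> * ?e)))"
      unfolding forcing_eq by (intro norm_triangle_le norm_triangle_le_diff add_mono 1)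
    then show ?thesis by (simp add: algebra_simps)
  qed
  then show ?thesis using B C0 K_nonneg
    by (intro exI[of _ "C * K + C * K + B * K * (1 + exp \<beta>)"]) auto
next
  \<comment> \<open>No sequence has a negative bound, so the constant 0 serves vacuously.\<close>
  case False
  then have "\<not> (\<forall>i. \<bar>f i\<bar> \<le> B)" for f :: "int \<Rightarrow> real"
    using order_trans[OF abs_ge_zero] by blast
  then show ?thesis by (intro exI[of _ 0]) blast
qed

lemma forcing_tendsto:
  assumes \<xi>: "\<xi>' \<longlonglongrightarrow> \<xi>" and F: "\<And>j. (\<lambda>n. F n j) \<longlonglongrightarrow> f j" "\<And>n j. \<bar>F n j\<bar> \<le> B"
  shows "(\<lambda>n. forcing \<phi> (\<xi>' n) c (F n) j) \<longlonglongrightarrow> forcing \<phi> \<xi> c f j"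
proof -
  have vec: "(\<lambda>n. vector [X n, Y n] :: real^2) \<longlonglongrightarrow> vector [x, y]"
    if "X \<longlonglongrightarrow> x" "Y \<longlonglongrightarrow> y" for X Y x y
  proof (rule vec_tendstoI)
    fix i :: 2
    show "(\<lambda>n. (vector [X n, Y n] :: real^2) $ i) \<longlonglongrightarrow> (vector [x, y] :: real^2) $ i"
      using exhaust_2[of i] that by auto
  qed
  have m: "(\<lambda>n. modulation \<phi> (\<xi>' n) c (F n)) \<longlonglongrightarrow> modulation \<phi> \<xi> c f"
    unfolding modulation_eq
    by (intro tendsto_scaleR tendsto_const vec bounded_linear.tendsto[OF matrix_vector_mul_bounded_linear]
        tendsto_infsum_localized[OF \<beta> q_decay(1) q_cont(1) \<xi> F]
        tendsto_infsum_localized[OF \<beta> q_decay(2) q_cont(2) \<xi> F])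
  have comp: "(\<lambda>n. g (of_int j - \<xi>' n)) \<longlonglongrightarrow> g (of_int j - \<xi>)"
    if "continuous_on UNIV g" for g :: "real \<Rightarrow> real^2" and j
    by (rule continuous_on_tendsto_compose[OF that]) (auto intro!: tendsto_intros \<xi>)
  show ?thesis
    unfolding forcing_eq
    by (intro tendsto_add tendsto_diff tendsto_scaleR tendsto_mult tendsto_const tendsto_vec_nth
        vec m F comp cont_x cont_c cont)
       (intro continuous_on_compose2[OF cont] continuous_intros subset_UNIV)
qed

section \<open>Symplectic orthogonality and translation covariance of the forcing\<close>

lemma abs_summable_decaying:
  fixes g :: "int \<Rightarrow> 'a::real_normed_vector"
  assumes "\<And>j. norm (g j) \<le> C * exp (- \<beta> * \<bar>of_int j - \<xi>\<bar>)"
  shows "(\<lambda>j. norm (g j)) summable_on UNIV"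
  by (rule summable_on_comparison_test[OF summable_on_cmult_right[OF summable_exp_int_shift[OF \<beta>]]])
    (use assms in auto)

lemma abs_summable_tangent:
  "(\<lambda>j. norm (d_xi \<phi> \<xi> c j)) summable_on UNIV" "(\<lambda>j. norm (d_c \<phi> \<xi> c j)) summable_on UNIV"
  using abs_summable_decaying[of "d_xi \<phi> \<xi> c" K \<xi>] abs_summable_decaying[of "d_c \<phi> \<xi> c" K \<xi>]
    decay_x decay_c by (simp_all add: d_xi_eq d_c_eq)

lemma A_mat_invertible: "invertible (A_mat \<phi> c)"
  using \<alpha>\<^sub>0_pos by (simp add: invertible_det_nz det_2 A_mat_def)

lemma A_mat_inverse: "A_mat \<phi> c ** matrix_inv (A_mat \<phi> c) = mat 1"
  using someI_ex[OF A_mat_invertible[unfolded invertible_def]] unfolding matrix_inv_def by blast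

text \<open>Multiplication by \<open>A_mat\<close> undoes its inverse, and the factor 1/2 absorbs
  the 2 from differentiating a square. What remains has the form that summation by parts gives for
  the noise term.\<close>

lemma A_mat_modulation:
  "A_mat \<phi> c *v modulation \<phi> \<xi> c f = vector
     [- (\<Sum>\<^sub>\<infinity>j. d_xi \<phi> \<xi> c j $ 1 * (f j * wave \<phi> \<xi> c j $ 1)),
      - (\<Sum>\<^sub>\<infinity>j. d_c \<phi> \<xi> c j $ 1 * (f j * wave \<phi> \<xi> c j $ 1))]"
proof -
  have half: "(- 1/2) * (\<Sum>\<^sub>\<infinity>j. 2 * g j) = - (\<Sum>\<^sub>\<infinity>j. g j)" for g :: "int \<Rightarrow> real"
    by (subst infsum_cmult_right') simp
  have "A_mat \<phi> c *v modulation \<phi> \<xi> c f = (- 1/2) *\<^sub>R vector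
     [\<Sum>\<^sub>\<infinity>j. q_xi (of_int j - \<xi>) * f j, \<Sum>\<^sub>\<infinity>j. q_c (of_int j - \<xi>) * f j]"
    unfolding modulation_eq
    by (simp only: matrix_vector_mult_scaleR matrix_vector_mul_assoc
        A_mat_inverse matrix_vector_mul_lid)
  also have "\<dots> = vector
     [(- 1/2) * (\<Sum>\<^sub>\<infinity>j. 2 * (d_xi \<phi> \<xi> c j $ 1 * (f j * wave \<phi> \<xi> c j $ 1))),
      (- 1/2) * (\<Sum>\<^sub>\<infinity>j. 2 * (d_c \<phi> \<xi> c j $ 1 * (f j * wave \<phi> \<xi> c j $ 1)))]"
    by (simp add: vec_eq_iff forall_2 q_xi_def q_c_def d_xi_eq d_c_eq wave_def mult_ac)
  finally show ?thesis unfolding half .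
qed

text \<open>The modulation parameters are chosen so that the forcing is symplectically orthogonal to the
  tangent vectors, which places it in the stable subspace.\<close>

lemma forcing_orthogonal:
  assumes f: "\<And>j. \<bar>f j\<bar> \<le> B"
  shows "\<Omega> (d_xi \<phi> \<xi> c) (forcing \<phi> \<xi> c f) = 0" "\<Omega> (d_c \<phi> \<xi> c) (forcing \<phi> \<xi> c f) = 0"
proof -
  let ?h = "\<lambda>i. f i * wave \<phi> \<xi> c i $ 1" and ?m = "modulation \<phi> \<xi> c f"
  have B: "0 \<le> B" using order_trans[OF abs_ge_zero f] by blast
  have h_le: "\<bar>?h j\<bar> \<le> B * K * exp (- \<beta> * \<bar>of_int j - \<xi>\<bar>)" for j
  proof -
    have "\<bar>f j\<bar> * \<bar>wave \<phi> \<xi> c j $ 1\<bar> \<le> B * (K * exp (- \<beta> * \<bar>of_int j - \<xi>\<bar>))"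
      unfolding wave_def using f B
      by (intro mult_mono order_trans[OF component_le_norm_cart decay]) auto
    then show ?thesis by (simp add: abs_mult mult.assoc)
  qed
  have h: "(\<lambda>j. \<bar>?h j\<bar>) summable_on UNIV"
    using abs_summable_decaying[of ?h "B * K" \<xi>] h_le by simp
  have "(\<lambda>j. \<bar>?h (j + - 1)\<bar>) summable_on UNIV"
    using h summable_on_shift_int(1)[of "\<lambda>j. \<bar>?h j\<bar>" "- 1"] by simp
  with h have "(\<lambda>j. \<bar>?h j\<bar> + \<bar>?h (j + - 1)\<bar>) summable_on UNIV" by (rule summable_on_add)
  then have bd: "(\<lambda>j. norm (vector [0, bdiff ?h j] :: real^2)) summable_on UNIV"
    by (rule summable_on_comparison_test)
      (auto intro!: order_trans[OF norm_vector2_le] abs_triangle_ineq4 simp: bdiff_def)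
  \<comment> \<open>Stated for a general summable \<open>g\<close>, to be used with both tangent
    vectors.\<close>
  have "\<Omega> g (forcing \<phi> \<xi> c f) = - (?m $ 1) * \<Omega> g (d_xi \<phi> \<xi> c) - ?m $ 2 * \<Omega> g (d_c \<phi> \<xi> c)
      - (\<Sum>\<^sub>\<infinity>j. g j $ 1 * ?h j)"
    if "(\<lambda>j. norm (g j)) summable_on UNIV" for g
    unfolding forcing_def[abs_def]
    using \<Omega>_lincomb[OF that abs_summable_tangent bd] \<Omega>_bdiff[OF that h] by simp
  note 1 = this[OF abs_summable_tangent(1)] this[OF abs_summable_tangent(2)]
  have "A_mat \<phi> c $ 1 $ 1 * ?m $ 1 + A_mat \<phi> c $ 1 $ 2 * ?m $ 2 = (A_mat \<phi> c *v ?m) $ 1"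
    "A_mat \<phi> c $ 2 $ 1 * ?m $ 1 + A_mat \<phi> c $ 2 $ 2 * ?m $ 2 = (A_mat \<phi> c *v ?m) $ 2"
    by (simp_all add: matrix_vector_mult_def sum_2)
  \<comment> \<open>With the entries of \<open>A_mat\<close> read as symplectic pairings, each row
    is exactly the cancellation required in the corresponding expansion.\<close>
  note 2 = this[unfolded A_mat_modulation, folded gram[of \<xi>]]
  show "\<Omega> (d_xi \<phi> \<xi> c) (forcing \<phi> \<xi> c f) = 0" "\<Omega> (d_c \<phi> \<xi> c) (forcing \<phi> \<xi> c f) = 0"
    unfolding 1 using 2 by (simp_all add: algebra_simps)
qed

text \<open>A wave displaced by an integer sees the lattice as before, so displacing it amounts to
  translating the noise the other way.\<close>

lemma forcing_shift:
  "forcing \<phi> (\<xi> + of_int d) c f (j + d) = forcing \<phi> \<xi> c (\<lambda>i. f (i + d)) j"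
proof -
  have s: "(\<Sum>\<^sub>\<infinity>j. q (of_int j - (\<xi> + of_int d)) * f j) = (\<Sum>\<^sub>\<infinity>j. q (of_int j - \<xi>) * f (j + d))"
    for q :: "real \<Rightarrow> real"
    using summable_on_shift_int(2)[of "\<lambda>j. q (of_int j - (\<xi> + of_int d)) * f j" d] by simp
  have "modulation \<phi> (\<xi> + of_int d) c f = modulation \<phi> \<xi> c (\<lambda>i. f (i + d))"
    unfolding modulation_eq s ..
  moreover have "of_int (j + d) - (\<xi> + of_int d) = of_int j - \<xi>" by simp
  moreover have "f (j + d - 1) = f (j - 1 + d)" by (simp add: algebra_simps)
  ultimately show ?thesis unfolding forcing_eq by simp
qed

text \<open>For unbounded \<open>f\<close> the sequence may fail to be square summable and
  \<open>Abs_ell2\<close> is then unspecified; the facts below therefore assume a bound on the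
  noise.\<close>

definition Forcing :: "real \<Rightarrow> (int \<Rightarrow> real) \<Rightarrow> ell2"
  where "Forcing \<xi> f = Abs_ell2 (forcing \<phi> \<xi> c f)"

lemma ell2_seq_Forcing:
  assumes f: "\<And>j. \<bar>f j\<bar> \<le> B"
  shows "ell2_seq (Forcing \<xi> f) = forcing \<phi> \<xi> c f"
proof -
  obtain C where C: "norm (forcing \<phi> \<xi> c f j) \<le> C * exp (- \<beta> * \<bar>of_int j - \<xi>\<bar>)" for j
    using forcing_decay[of B] f by blast
  have "(\<lambda>j. (norm (forcing \<phi> \<xi> c f j))\<^sup>2) summable_on UNIV"
    by (rule summable_on_comparison_test[OF
          summable_exp_int_shift_square[OF \<beta>, of C \<xi>] power_mono[OF C]]) auto
  then show ?thesis unfolding Forcing_def by (rule ell2_seq_Abs_ell2)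
qed

text \<open>Position and noise vary together, so this yields both the continuity in time of the
  Duhamel integrand and its continuity in the noise.\<close>

lemma Forcing_tendsto:
  assumes \<xi>: "\<xi>' \<longlonglongrightarrow> \<xi>" and F: "\<And>j. (\<lambda>n. F n j) \<longlonglongrightarrow> f j" "\<And>n j. \<bar>F n j\<bar> \<le> B"
  shows "(\<lambda>n. Forcing (\<xi>' n) (F n)) \<longlonglongrightarrow> Forcing \<xi> f"
proof -
  have f: "\<bar>f j\<bar> \<le> B" for j
    by (rule LIMSEQ_le_const2[OF tendsto_rabs[OF F(1)]]) (use F(2) in auto)
  obtain \<rho> where \<rho>: "\<And>n. \<bar>\<xi>' n\<bar> \<le> \<rho>" using \<xi> by (rule convergent_bounded_by) blast
  obtain C where C: "0 \<le> C" "\<And>n j. norm (forcing \<phi> (\<xi>' n) c (F n) j)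
      \<le> C * exp (- \<beta> * \<bar>of_int j - \<xi>' n\<bar>)"
    using forcing_decay[of B] F(2) by blast
  show ?thesis
  proof (rule tendsto_ell2_dominated)
    show "(\<lambda>j::int. (C * exp (\<beta> * \<rho>) * exp (- \<beta> * \<bar>of_int j - 0\<bar>))\<^sup>2) summable_on UNIV"
      by (rule summable_exp_int_shift_square[OF \<beta>])
    show "norm (ell2_seq (Forcing (\<xi>' n) (F n)) j)
        \<le> C * exp (\<beta> * \<rho>) * exp (- \<beta> * \<bar>of_int j - 0\<bar>)" for n j
      unfolding ell2_seq_Forcing[OF F(2)]
      using order_trans[OF C(2) mult_left_mono[OF exp_decay_translate_le[OF _ \<rho>] C(1)]] \<beta>
      by (simp add: mult.assoc)
    show "(\<lambda>n. ell2_seq (Forcing (\<xi>' n) (F n)) j) \<longlonglongrightarrow> ell2_seq (Forcing \<xi> f) j" for j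
      unfolding ell2_seq_Forcing[OF F(2)] ell2_seq_Forcing[OF f]
      by (rule forcing_tendsto[OF \<xi> F])
  qed
qed

lemma Forcing_weighted:
  assumes a: "0 < a" "a < \<beta>"
  shows "\<exists>C. \<forall>\<xi> f. (\<forall>j. \<bar>f j\<bar> \<le> B) \<longrightarrow> weighted_summable a \<xi> (ell2_seq (Forcing \<xi> f)) \<and>
    weighted_norm a \<xi> (ell2_seq (Forcing \<xi> f)) \<le> C"
proof -
  obtain C where C: "0 \<le> C" "\<And>\<xi> f j. \<forall>i. \<bar>f i\<bar> \<le> B \<Longrightarrow>
      norm (forcing \<phi> \<xi> c f j) \<le> C * exp (- \<beta> * \<bar>of_int j - \<xi>\<bar>)"
    using forcing_decay[of B] by blast
  \<comment> \<open>The weight grows at rate at most \<open>a\<close> and the forcing decays at rate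
    \<open>\<beta>\<close>; the factor 2 comes from squaring.\<close>
  define \<gamma> where "\<gamma> = 2 * (\<beta> - a)"
  have \<gamma>: "0 < \<gamma>" using a by (simp add: \<gamma>_def)
  define S where "S = sqrt (C\<^sup>2 * (exp \<gamma> * (\<Sum>\<^sub>\<infinity>j::int. exp (- \<gamma> * \<bar>of_int j\<bar>))))"
  have "weighted_summable a \<xi> (ell2_seq (Forcing \<xi> f)) \<and>
      weighted_norm a \<xi> (ell2_seq (Forcing \<xi> f)) \<le> S"
    if f: "\<forall>j. \<bar>f j\<bar> \<le> B" for \<xi> f
  proof -
    let ?w = "\<lambda>j. (norm (exp (a * (of_int j - \<xi>)) *\<^sub>R forcing \<phi> \<xi> c f j))\<^sup>2"
    have le: "?w j \<le> C\<^sup>2 * exp (- \<gamma> * \<bar>of_int j - \<xi>\<bar>)" for j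
    proof -
      have "norm (exp (a * (of_int j - \<xi>)) *\<^sub>R forcing \<phi> \<xi> c f j)
          \<le> exp (a * \<bar>of_int j - \<xi>\<bar>) * (C * exp (- \<beta> * \<bar>of_int j - \<xi>\<bar>))"
        unfolding norm_scaleR using a by (intro mult_mono C(2) f) auto
      also have "\<dots> = C * exp (- (\<beta> - a) * \<bar>of_int j - \<xi>\<bar>)"
        by (simp add: mult.left_commute mult_exp_exp algebra_simps)
      finally have "?w j \<le> (C * exp (- (\<beta> - a) * \<bar>of_int j - \<xi>\<bar>))\<^sup>2"
        by (rule power_mono) simp
      then show ?thesis
        unfolding \<gamma>_def power_mult_distrib exp_double[symmetric] by (simp add: algebra_simps)
    qed
    have sum: "(\<lambda>j::int. C\<^sup>2 * exp (- \<gamma> * \<bar>of_int j - \<xi>\<bar>)) summable_on UNIV"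
      by (intro summable_on_cmult_right summable_exp_int_shift \<gamma>)
    have w: "?w summable_on UNIV"
      by (rule summable_on_comparison_test[OF sum le]) auto
    have "(\<Sum>\<^sub>\<infinity>j. ?w j) \<le> (\<Sum>\<^sub>\<infinity>j::int. C\<^sup>2 * exp (- \<gamma> * \<bar>of_int j - \<xi>\<bar>))"
      by (rule infsum_mono[OF w sum le])
    also have "\<dots> = C\<^sup>2 * (\<Sum>\<^sub>\<infinity>j::int. exp (- \<gamma> * \<bar>of_int j - \<xi>\<bar>))"
      by (rule infsum_cmult_right')
    also have "\<dots> \<le> C\<^sup>2 * (exp \<gamma> * (\<Sum>\<^sub>\<infinity>j::int. exp (- \<gamma> * \<bar>of_int j\<bar>)))"
      by (intro mult_left_mono infsum_exp_int_shift_le \<gamma>) simp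
    finally show ?thesis
      unfolding weighted_summable_def weighted_norm_def S_def
        ell2_seq_Forcing[OF f[rule_format]]
      using w by (auto intro: real_sqrt_le_mono)
  qed
  then show ?thesis by blast
qed

end

section \<open>The response to bounded noise\<close>

lemma ell2_seq_shift: "ell2_seq (shift_ell2 d w) j = ell2_seq w (j + d)"
  by (simp add: shift_ell2.rep_eq)

lemma bounded_linear_shift_ell2: "bounded_linear (shift_ell2 d)"
proof (rule bounded_linear_intro[where K = 1])
  show "norm (shift_ell2 d w) \<le> norm w * 1" for w
  proof -
    have "(norm (shift_ell2 d w))\<^sup>2 = (norm w)\<^sup>2"
      unfolding norm_ell2_power2 ell2_seq_shift by (rule summable_on_shift_int(2))
    then show ?thesis by simp
  qed
qed (simp_all add: ell2_seq_inject[symmetric] fun_eq_iff ell2_seq_shift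
    plus_ell2.rep_eq scaleR_ell2.rep_eq)

lemma shift_J_ell2: "shift_ell2 d (J_ell2 w) = J_ell2 (shift_ell2 d w)"
  by (simp add: ell2_seq_inject[symmetric] fun_eq_iff ell2_seq_shift J_ell2.rep_eq J_op_def
      fdiff_def bdiff_def algebra_simps)

lemma integrable_exp_at_bot:
  fixes b t :: real
  assumes "0 < b"
  shows "integrable lborel (\<lambda>s. indicator {..t} s * exp (b * s))"
proof -
  have "(\<lambda>s. exp (- b * s)) absolutely_integrable_on {- t..}"
    using assms integrable_on_exp_minus_to_infinity by (intro nonnegative_absolutely_integrable_1) auto
  then have "integrable lborel (\<lambda>s. indicator {- t..} s * exp (- b * s))"
    by (simp add: set_integrable_def integrable_completion)
  \<comment> \<open>Reflection of the time axis turns decay at plus infinity into decay at minus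
    infinity.\<close>
  from lborel_integrable_real_affine[OF this, of "-1" 0] show ?thesis
    by (simp add: indicator_def)
qed

text \<open>A single summand is at most the whole sum; removing its weight costs an exponential
  factor that depends only on the site and the centre.\<close>

lemma norm_le_weighted_norm:
  assumes "weighted_summable a \<xi> w"
  shows "norm (w j) \<le> exp (- (a * (of_int j - \<xi>))) * weighted_norm a \<xi> w"
proof -
  let ?w = "\<lambda>j. (norm (exp (a * (of_int j - \<xi>)) *\<^sub>R w j))\<^sup>2"
  have "sum ?w {j} \<le> infsum ?w UNIV"
    using assms by (intro finite_sum_le_infsum) (auto simp: weighted_summable_def)
  then have "sqrt (?w j) \<le> weighted_norm a \<xi> w"
    unfolding weighted_norm_def by (intro real_sqrt_le_mono) simp
  then have "exp (a * (of_int j - \<xi>)) * norm (w j) \<le> weighted_norm a \<xi> w" by simp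
  from mult_left_mono[OF this, of "exp (- (a * (of_int j - \<xi>)))"] show ?thesis
    by (simp add: mult.assoc[symmetric] mult_exp_exp)
qed

section \<open>Duhamel integrals driven by bounded noise\<close>

locale stable_wave = solitary_wave +
  fixes a :: real and A :: "real \<Rightarrow> ell2 \<Rightarrow>\<^sub>L ell2" and U :: "real \<Rightarrow> real \<Rightarrow> ell2 \<Rightarrow>\<^sub>L ell2"
    and L b :: real
  assumes a: "0 < a" "a < \<beta>" and c: "0 < c"
    and A_shift: "\<And>\<eta> j d t. ell2_seq (A (c * t) \<eta>) (j + d)
             = ell2_seq (A (c * t - of_int d) (shift_ell2 d \<eta>)) j"
    and gen: "generates_evolution_family (\<lambda>t w. J_ell2 (A (c * t) w)) U"
    and Lb: "0 < L" "0 < b"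
    and stable: "\<And>t s w. s \<le> t \<Longrightarrow> weighted_summable a (c * s) (ell2_seq w) \<Longrightarrow>
         \<Omega> (d_xi \<phi> (c * s) c) (ell2_seq w) = 0 \<Longrightarrow>
         \<Omega> (d_c \<phi> (c * s) c) (ell2_seq w) = 0 \<Longrightarrow>
         weighted_summable a (c * t) (ell2_seq (U t s w)) \<and>
         weighted_norm a (c * t) (ell2_seq (U t s w))
           \<le> L * exp (- b * (t - s)) * weighted_norm a (c * s) (ell2_seq w)"
begin

text \<open>With \<open>t\<close> and \<open>j\<close> fixed, the inverse weight at the site and the
  factor \<open>exp (- b * t)\<close> are constants. As \<open>D\<close> depends neither on
  \<open>s\<close> nor on the noise, one integrable majorant serves all noises bounded by
  \<open>B\<close>.\<close>

lemma evolved_forcing_decay: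
  "\<exists>D. \<forall>f s. (\<forall>i. \<bar>f i\<bar> \<le> B) \<longrightarrow> s \<le> t \<longrightarrow>
     norm (ell2_seq (U t s (Forcing (c * s) f)) j) \<le> D * exp (b * s)"
proof -
  obtain C where C: "\<And>\<xi> f. \<forall>j. \<bar>f j\<bar> \<le> B \<Longrightarrow> weighted_summable a \<xi> (ell2_seq (Forcing \<xi> f)) \<and>
      weighted_norm a \<xi> (ell2_seq (Forcing \<xi> f)) \<le> C"
    using Forcing_weighted[OF a, of B] by blast
  let ?x = "exp (- (a * (of_int j - c * t)))"
  have "norm (ell2_seq (U t s (Forcing (c * s) f)) j) \<le> (?x * (L * exp (- b * t) * C)) * exp (b * s)"
    if f: "\<forall>i. \<bar>f i\<bar> \<le> B" and s: "s \<le> t" for f s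
  proof -
    let ?w = "Forcing (c * s) f"
    note w = C[OF f, of "c * s"]
    have orth: "\<Omega> (d_xi \<phi> (c * s) c) (ell2_seq ?w) = 0" "\<Omega> (d_c \<phi> (c * s) c) (ell2_seq ?w) = 0"
      unfolding ell2_seq_Forcing[OF f[rule_format]]
      by (rule forcing_orthogonal[OF f[rule_format]])+
    note st = stable[OF s conjunct1[OF w] orth]
    have "norm (ell2_seq (U t s ?w) j) \<le> ?x * weighted_norm a (c * t) (ell2_seq (U t s ?w))"
      by (rule norm_le_weighted_norm) (use st in blast)
    also have "\<dots> \<le> ?x * (L * exp (- b * (t - s)) * C)"
      using order_trans[OF conjunct2[OF st] mult_left_mono[OF conjunct2[OF w]]] Lb
      by (intro mult_left_mono) auto
    also have "exp (- b * (t - s)) = exp (- b * t) * exp (b * s)"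
      by (simp add: mult_exp_exp algebra_simps)
    finally show ?thesis by (simp add: mult_ac)
  qed
  then show ?thesis by blast
qed

lemma continuous_on_evolved_forcing:
  assumes f: "\<And>i. \<bar>f i\<bar> \<le> B"
  shows "continuous_on {..t} (\<lambda>s. ell2_seq (U t s (Forcing (c * s) f)) j)"
proof -
  have "continuous_on UNIV (\<lambda>s. Forcing (c * s) f)"
    unfolding continuous_on_sequentially o_def
    by (auto intro!: Forcing_tendsto[where B = B] tendsto_intros f)
  then have *: "continuous_on {s..t} (\<lambda>s. U t s (Forcing (c * s) f))" for s
    by (intro evolution_continuous_on[OF gen]) (rule continuous_on_subset, auto)
  have "continuous (at s within {..t}) (\<lambda>s. U t s (Forcing (c * s) f))" if "s \<le> t" for s
  proof -
    \<comment> \<open>Operator bounds are available on compact intervals only; since continuity is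
      local, the half-line can be cut off just below \<open>s\<close>.\<close>
    have "at s within {..t} = at s within {s - 1..t}"
      by (rule at_within_nhd[of _ "{s - 1<..}"]) auto
    then show ?thesis
      using *[of "s - 1"] that by (simp add: continuous_on_eq_continuous_within)
  qed
  then have "continuous_on {..t} (\<lambda>s. U t s (Forcing (c * s) f))"
    by (simp add: continuous_on_eq_continuous_within)
  then show ?thesis by (rule bounded_linear.continuous_on[OF bounded_linear_ell2_seq])
qed

text \<open>The integration set is a parameter, so that the response accumulated over a finite time
  and the limiting response over a half-line are values of the same function.\<close>

definition response :: "real \<Rightarrow> int \<Rightarrow> real set \<Rightarrow> (int \<Rightarrow> real) \<Rightarrow> real^2"
  where "response t j S f = (LINT s:S|lborel. ell2_seq (U t s (Forcing (c * s) f)) j)"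

lemma evolved_forcing_measurable:
  assumes "\<And>i. \<bar>f i\<bar> \<le> B" "S \<in> sets borel" "S \<subseteq> {..t}"
  shows "(\<lambda>s. indicator S s *\<^sub>R ell2_seq (U t s (Forcing (c * s) f)) j) \<in> borel_measurable lborel"
  using borel_measurable_continuous_on_indicator[OF assms(2)
      continuous_on_subset[OF continuous_on_evolved_forcing[OF assms(1)] assms(3)]] by simp

text \<open>Dominated convergence in both arguments at once. With the set fixed it gives continuity
  in the noise, with the noise fixed it gives the limit of long times.\<close>

lemma response_tendsto:
  assumes F: "\<And>i. (\<lambda>n. F n i) \<longlonglongrightarrow> f i" "\<And>n i. \<bar>F n i\<bar> \<le> B"
    and T: "\<And>n. T n \<in> sets borel" "\<And>n. T n \<subseteq> {..t}"
    and S: "S \<in> sets borel" "S \<subseteq> {..t}"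
    and TS: "\<And>s. (\<lambda>n. indicator (T n) s :: real) \<longlonglongrightarrow> indicator S s"
  shows "(\<lambda>n. response t j (T n) (F n)) \<longlonglongrightarrow> response t j S f"
proof -
  have f: "\<bar>f i\<bar> \<le> B" for i
    by (rule LIMSEQ_le_const2[OF tendsto_rabs[OF F(1)]]) (use F(2) in auto)
  obtain D where D: "\<And>f s. \<forall>i. \<bar>f i\<bar> \<le> B \<Longrightarrow> s \<le> t \<Longrightarrow>
      norm (ell2_seq (U t s (Forcing (c * s) f)) j) \<le> D * exp (b * s)"
    using evolved_forcing_decay[of B t j] by blast
  have D0: "0 \<le> D"
    using order_trans[OF norm_ge_zero D[of f t]] f by (simp add: zero_le_mult_iff)
  show ?thesis
    unfolding response_def set_lebesgue_integral_def
  proof (rule integral_dominated_convergence)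
    show "integrable lborel (\<lambda>s. D * (indicator {..t} s * exp (b * s)))"
      by (intro integrable_mult_right integrable_exp_at_bot Lb)
    show "(\<lambda>s. indicator S s *\<^sub>R ell2_seq (U t s (Forcing (c * s) f)) j) \<in> borel_measurable lborel"
      by (rule evolved_forcing_measurable[OF f S])
    show "(\<lambda>s. indicator (T n) s *\<^sub>R ell2_seq (U t s (Forcing (c * s) (F n))) j) \<in> borel_measurable lborel" for n
      by (rule evolved_forcing_measurable[OF F(2) T])
    show "AE s in lborel. (\<lambda>n. indicator (T n) s *\<^sub>R ell2_seq (U t s (Forcing (c * s) (F n))) j)
        \<longlonglongrightarrow> indicator S s *\<^sub>R ell2_seq (U t s (Forcing (c * s) f)) j"
      by (intro AE_I2 tendsto_scaleR TS bounded_linear.tendsto[OF bounded_linear_ell2_seq]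
          blinfun.tendsto tendsto_const Forcing_tendsto[OF _ F])
    show "AE s in lborel. norm (indicator (T n) s *\<^sub>R ell2_seq (U t s (Forcing (c * s) (F n))) j)
        \<le> D * (indicator {..t} s * exp (b * s))" for n
      using D[of "F n"] F(2) T(2)[of n] D0 by (auto simp: indicator_def)
  qed
qed

lemma evolved_forcing_integrable:
  assumes f: "\<And>i. \<bar>f i\<bar> \<le> B" and S: "S \<in> sets borel" "S \<subseteq> {..t}"
  shows "set_integrable lborel S (\<lambda>s. ell2_seq (U t s (Forcing (c * s) f)) j)"
proof -
  obtain D where D: "\<And>s. s \<le> t \<Longrightarrow>
      norm (ell2_seq (U t s (Forcing (c * s) f)) j) \<le> D * exp (b * s)"
    using evolved_forcing_decay[of B t j] f by blast
  have D0: "0 \<le> D"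
    using order_trans[OF norm_ge_zero D[of t]] by (simp add: zero_le_mult_iff)
  show ?thesis
    unfolding set_integrable_def
  proof (rule Bochner_Integration.integrable_bound)
    show "integrable lborel (\<lambda>s. D * (indicator {..t} s * exp (b * s)))"
      by (intro integrable_mult_right integrable_exp_at_bot Lb)
    show "(\<lambda>s. indicator S s *\<^sub>R ell2_seq (U t s (Forcing (c * s) f)) j) \<in> borel_measurable lborel"
      by (rule evolved_forcing_measurable[OF f S])
    show "AE s in lborel. norm (indicator S s *\<^sub>R ell2_seq (U t s (Forcing (c * s) f)) j)
        \<le> norm (D * (indicator {..t} s * exp (b * s)))"
      using D S(2) D0 by (auto simp: indicator_def)
  qed
qed

text \<open>In the frame moving with the wave, the solution at time \<open>(n + p) / c\<close> is the response
  accumulated since time \<open>- n / c\<close> to the noise translated by \<open>n\<close>.\<close>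

lemma solution_eq_response:
  assumes sol: "solves_forced_equation \<phi> c A f \<eta>" and f: "\<And>i. \<bar>f i\<bar> \<le> B" and p: "0 \<le> p"
  shows "\<eta> (j + int n) ((real n + p) / c)
    = response (p / c) j {- (real n / c)..p / c} (\<lambda>i. f (i + int n))"
proof -
  obtain H where H: "\<And>t j. 0 \<le> t \<Longrightarrow> \<eta> j t = ell2_seq (H t) j" "H 0 = 0"
    and dH: "\<And>t. 0 \<le> t \<Longrightarrow> \<exists>F. ell2_seq F = forcing \<phi> (c * t) c f \<and>
         (H has_vector_derivative J_ell2 (A (c * t) (H t)) + F) (at t within {0..})"
    using sol unfolding solves_forced_equation_def by blast
  define s0 t where "s0 = - (real n / c)" and "t = p / c"
  \<comment> \<open>The solution translated by \<open>n\<close> sites and started at time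
    \<open>s0\<close>. By then the wave of the original clock is at \<open>c * s + n\<close>, so
    after the translation it is centred at \<open>c * s\<close>, and covariance of \<open>A\<close>
    shows that \<open>V\<close> obeys the same equation with translated noise.\<close>
  define V where "V s = shift_ell2 (int n) (H (s - s0))" for s
  let ?f = "\<lambda>i. f (i + int n)"
  have f': "\<And>i. \<bar>?f i\<bar> \<le> B" using f by blast
  have s0t: "s0 \<le> t" using c p by (simp add: s0_def t_def field_simps)
  have cs: "c * (s - s0) = c * s + of_int (int n)" for s using c by (simp add: s0_def field_simps)
  have dV: "(V has_vector_derivative J_ell2 (A (c * s) (V s)) + Forcing (c * s) ?f) (at s within {s0..t})"
    if s: "s \<in> {s0..t}" for s
  proof -
    obtain F where F: "ell2_seq F = forcing \<phi> (c * (s - s0)) c f"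
      and "(H has_vector_derivative J_ell2 (A (c * (s - s0)) (H (s - s0))) + F) (at (s - s0) within {0..})"
      using dH[of "s - s0"] s by auto
    then have "(H has_vector_derivative J_ell2 (A (c * (s - s0)) (H (s - s0))) + F)
        (at (s - s0) within (\<lambda>s. s - s0) ` {s0..t})"
      by (elim has_vector_derivative_within_subset) auto
    moreover have "((\<lambda>s. s - s0) has_vector_derivative 1) (at s within {s0..t})"
      by (auto intro!: derivative_eq_intros)
    ultimately have "(H \<circ> (\<lambda>s. s - s0) has_vector_derivative
        J_ell2 (A (c * (s - s0)) (H (s - s0))) + F) (at s within {s0..t})"
      using vector_diff_chain_within by fastforce
    from bounded_linear.has_vector_derivative[OF bounded_linear_shift_ell2 this]
    have "(V has_vector_derivative shift_ell2 (int n) (J_ell2 (A (c * (s - s0)) (H (s - s0))) + F))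
        (at s within {s0..t})"
      by (simp add: V_def[abs_def] o_def)
    moreover have "shift_ell2 (int n) (A (c * (s - s0)) (H (s - s0))) = A (c * s) (V s)"
    proof -
      have "c * (s - s0) - of_int (int n) = c * s" by (simp add: cs)
      then show ?thesis
        using A_shift[of "s - s0" "H (s - s0)" _ "int n"]
        by (simp add: ell2_seq_inject[symmetric] fun_eq_iff ell2_seq_shift V_def)
    qed
    moreover have "shift_ell2 (int n) F = Forcing (c * s) ?f"
      unfolding ell2_seq_inject[symmetric] fun_eq_iff ell2_seq_shift F ell2_seq_Forcing[OF f'] cs
      by (simp only: forcing_shift simp_thms)
    ultimately show ?thesis
      by (simp add: linear_add[OF bounded_linear.linear[OF bounded_linear_shift_ell2]] shift_J_ell2)
  qed
  have "V s0 = 0"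
    by (simp add: V_def H(2) linear_0[OF bounded_linear.linear[OF bounded_linear_shift_ell2]])
  from duhamel[OF gen s0t this dV]
  have "((\<lambda>s. U t s (Forcing (c * s) ?f)) has_integral V t) {s0..t}" by simp
  from has_integral_linear[OF this bounded_linear_ell2_seq[of j]]
  have "((\<lambda>s. ell2_seq (U t s (Forcing (c * s) ?f)) j) has_integral ell2_seq (V t) j) {s0..t}"
    by (simp add: o_def)
  \<comment> \<open>Duhamel's formula yields a gauge integral, \<open>response\<close> is a Lebesgue
    integral; integrability makes the two agree.\<close>
  moreover have "response t j {s0..t} ?f
      = integral {s0..t} (\<lambda>s. ell2_seq (U t s (Forcing (c * s) ?f)) j)"
    unfolding response_def
    by (intro set_borel_integral_eq_integral(2) evolved_forcing_integrable[OF f']) auto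
  ultimately have "response t j {s0..t} ?f = ell2_seq (V t) j" by (simp add: integral_unique)
  also have "\<dots> = \<eta> (j + int n) (t - s0)" using H(1)[of "t - s0"] s0t by (simp add: V_def ell2_seq_shift)
  also have "t - s0 = (real n + p) / c" by (simp add: s0_def t_def add_divide_distrib)
  finally show ?thesis by (simp add: s0_def t_def)
qed

end

section \<open>Convergence in distribution\<close>

text \<open>The noise is bounded only almost surely. Truncation makes the response well behaved at
  every sequence without changing it where the bound holds.\<close>

definition clamp_seq :: "real \<Rightarrow> (int \<Rightarrow> real) \<Rightarrow> int \<Rightarrow> real"
  where "clamp_seq B f i = max (- B) (min B (f i))"

lemma abs_clamp_seq_le: "0 \<le> B \<Longrightarrow> \<bar>clamp_seq B f i\<bar> \<le> B"
  by (auto simp: clamp_seq_def)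

lemma clamp_seq_eq:
  assumes "\<And>i. \<bar>f i\<bar> \<le> B"
  shows "clamp_seq B f = f"
proof
  show "clamp_seq B f i = f i" for i using assms[of i] by (auto simp: clamp_seq_def)
qed

text \<open>Continuity for the product topology gives Borel measurability of a functional of
  infinitely many coordinates. With countably many coordinates this topology is first countable, so
  sequences suffice.\<close>

lemma (in stable_wave) continuous_response_clamp:
  assumes B: "0 \<le> B" and S: "S \<in> sets borel" "S \<subseteq> {..t}"
  shows "continuous_on UNIV (\<lambda>f. response t j S (clamp_seq B f))"
  unfolding continuous_on_sequentially o_def
proof safe
  fix F :: "nat \<Rightarrow> int \<Rightarrow> real" and f
  assume F: "F \<longlonglongrightarrow> f"
  have "(\<lambda>n. F n i) \<longlonglongrightarrow> f i" for i
    using continuous_on_tendsto_compose[OF continuous_on_product_coordinates F] by auto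
  then have "(\<lambda>n. clamp_seq B (F n) i) \<longlonglongrightarrow> clamp_seq B f i" for i
    unfolding clamp_seq_def by (intro tendsto_max tendsto_min tendsto_const)
  then show "(\<lambda>n. response t j S (clamp_seq B (F n))) \<longlonglongrightarrow> response t j S (clamp_seq B f)"
    by (rule response_tendsto[OF _ abs_clamp_seq_le[OF B] S S]) auto
qed

text \<open>The joint law is a product of copies of one marginal, and such a product is invariant
  under injective reindexing.\<close>

lemma (in prob_space) distr_shift_iid:
  fixes \<kappa> :: "int \<Rightarrow> 'a \<Rightarrow> real"
  assumes indep: "indep_vars (\<lambda>_. borel) \<kappa> UNIV"
    and id: "\<And>i j. distr M borel (\<kappa> i) = distr M borel (\<kappa> j)"
  shows "distr M borel (\<lambda>\<omega> i. \<kappa> (i + d) \<omega>) = distr M borel (\<lambda>\<omega> i. \<kappa> i \<omega>)"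
proof -
  let ?P = "\<Pi>\<^sub>M i\<in>(UNIV :: int set). (borel :: real measure)"
  let ?\<nu> = "distr M borel (\<kappa> 0)"
  have rv: "random_variable borel (\<kappa> i)" for i
    using indep by (simp add: indep_vars_def)
  have ps: "prob_space ?\<nu>" by (rule prob_space_distr[OF rv])
  have seq: "(\<lambda>\<omega> i. \<kappa> i \<omega>) \<in> measurable M ?P"
    by (rule measurable_PiM_single') (auto simp: rv)
  have sh: "(\<lambda>f i. f (i + d)) \<in> measurable ?P ?P"
    by (rule measurable_PiM_single') auto
  have "distr M ?P (\<lambda>\<omega> i. \<kappa> i \<omega>) = (\<Pi>\<^sub>M i\<in>UNIV. distr M borel (\<kappa> i))"
    using iffD1[OF indep_vars_iff_distr_eq_PiM indep] rv by (simp add: restrict_UNIV)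
  also have "\<dots> = (\<Pi>\<^sub>M i\<in>UNIV. ?\<nu>)" by (intro PiM_cong refl id)
  finally have law: "distr M ?P (\<lambda>\<omega> i. \<kappa> i \<omega>) = (\<Pi>\<^sub>M i\<in>UNIV. ?\<nu>)" .
  have "distr M ?P (\<lambda>\<omega> i. \<kappa> (i + d) \<omega>) = distr (distr M ?P (\<lambda>\<omega> i. \<kappa> i \<omega>)) ?P (\<lambda>f i. f (i + d))"
    by (subst distr_distr[OF sh seq]) (simp add: o_def)
  also have "\<dots> = distr (\<Pi>\<^sub>M i\<in>(UNIV :: int set). ?\<nu>) (\<Pi>\<^sub>M i\<in>(UNIV :: int set). ?\<nu>) (\<lambda>f. \<lambda>i\<in>UNIV. f (i + d))"
    unfolding law by (intro distr_cong sets_PiM_cong) auto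
  also have "\<dots> = (\<Pi>\<^sub>M i\<in>UNIV. ?\<nu>)"
    by (rule distr_PiM_reindex) (auto simp: ps inj_on_def)
  finally have "distr M ?P (\<lambda>\<omega> i. \<kappa> (i + d) \<omega>) = distr M ?P (\<lambda>\<omega> i. \<kappa> i \<omega>)" unfolding law .
  \<comment> \<open>For countably many coordinates the product sigma-algebra is the Borel
    sigma-algebra of the product topology, the one for which the response is measurable.\<close>
  moreover have "distr M ?P g = distr M borel g" for g
    by (intro distr_cong refl) (rule sets_PiM_equal_borel)
  ultimately show ?thesis by simp
qed

text \<open>The preimages under \<open>f\<close> and \<open>g\<close> differ by a subset of a null
  set, which the completion contains. It supplies measurability of the solution, which is specified
  only almost surely.\<close>

lemma measurable_completion_AE:
  assumes "g \<in> measurable M N" "AE x in M. f x = g x" "\<And>x. f x \<in> space N"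
  shows "f \<in> measurable (completion M) N"
proof (rule measurableI)
  fix S assume S: "S \<in> sets N"
  have g: "g -` S \<inter> space M \<in> sets (completion M)"
    using measurable_sets[OF measurable_completion[OF assms(1)] S] by simp
  have "AE x in completion M. x \<in> g -` S \<inter> space M \<longleftrightarrow> x \<in> f -` S \<inter> space M"
    using AE_completion[OF assms(2)] by eventually_elim auto
  from completion.in_sets_AE[OF this g] show "f -` S \<inter> space (completion M) \<in> sets (completion M)"
    by auto
qed (rule assms(3))

text \<open>The integrals see only the law, so \<open>X n\<close> may be exchanged first for the
  measurable version \<open>Z n\<close> and then for \<open>Y n\<close>, where pointwise convergence
  is available.\<close>

lemma converges_in_distributionI:
  fixes X :: "nat \<Rightarrow> 'w \<Rightarrow> 'b::{metric_space, second_countable_topology}"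
  assumes ps: "prob_space M"
    and Z: "\<And>n. Z n \<in> borel_measurable M" "\<And>n. AE \<omega> in M. X n \<omega> = Z n \<omega>"
    and law: "\<And>n. distr M borel (Z n) = distr M borel (Y n)"
    and Y: "\<And>n. Y n \<in> borel_measurable M" "\<And>\<omega>. (\<lambda>n. Y n \<omega>) \<longlonglongrightarrow> Y' \<omega>"
  shows "converges_in_distribution (completion M) X Y'"
  unfolding converges_in_distribution_def
proof (intro conjI allI impI)
  interpret prob_space M by (rule ps)
  have Y': "Y' \<in> borel_measurable M"
    by (rule borel_measurable_LIMSEQ_metric[OF Y(1)]) (rule Y(2))
  show X: "X n \<in> borel_measurable (completion M)" for n
    by (rule measurable_completion_AE[OF Z]) simp
  show Yc: "Y' \<in> borel_measurable (completion M)" by (rule measurable_completion[OF Y'])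
  fix g :: "'b \<Rightarrow> real"
  assume g: "continuous_on UNIV g" and "bounded (range g)"
  then obtain C where C: "\<bar>g y\<bar> \<le> C" for y unfolding bounded_iff by auto
  have gm [measurable]: "g \<in> borel_measurable borel"
    using g by (rule borel_measurable_continuous_onI)
  have "(LINT y|distr (completion M) borel (X n). g y) = (LINT \<omega>|M. g (Y n \<omega>))" for n
  proof -
    have "(LINT y|distr (completion M) borel (X n). g y) = (LINT \<omega>|completion M. g (X n \<omega>))"
      by (rule integral_distr[OF X gm])
    also have "\<dots> = (LINT \<omega>|completion M. g (Z n \<omega>))"
      using AE_completion[OF Z(2)[of n]]
      by (intro integral_cong_AE measurable_compose[OF X gm]
          measurable_compose[OF measurable_completion[OF Z(1)] gm]) auto
    also have "\<dots> = (LINT \<omega>|M. g (Z n \<omega>))"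
      by (rule integral_completion[OF measurable_compose[OF Z(1) gm]])
    also have "\<dots> = (LINT y|distr M borel (Z n). g y)" by (rule integral_distr[OF Z(1) gm, symmetric])
    also have "\<dots> = (LINT \<omega>|M. g (Y n \<omega>))" unfolding law by (rule integral_distr[OF Y(1) gm])
    finally show ?thesis .
  qed
  moreover have "(LINT y|distr (completion M) borel Y'. g y) = (LINT \<omega>|M. g (Y' \<omega>))"
    using integral_distr[OF Yc gm] integral_completion[OF measurable_compose[OF Y' gm]] by simp
  moreover have "(\<lambda>n. LINT \<omega>|M. g (Y n \<omega>)) \<longlonglongrightarrow> (LINT \<omega>|M. g (Y' \<omega>))"
  proof (rule integral_dominated_convergence)
    show "integrable M (\<lambda>_. C)" by simp
    show "AE \<omega> in M. (\<lambda>n. g (Y n \<omega>)) \<longlonglongrightarrow> g (Y' \<omega>)"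
      by (intro AE_I2 continuous_on_tendsto_compose[OF g] Y(2)) auto
  qed (use C Y(1) Y' in \<open>auto intro: measurable_compose[OF _ gm]\<close>)
  ultimately show "(\<lambda>n. LINT y|distr (completion M) borel (X n). g y)
      \<longlonglongrightarrow> (LINT y|distr (completion M) borel Y'. g y)" by simp
qed

section \<open>From the wave family to a single speed, and the conclusion\<close>

lemma solitary_wave_at_speed:
  assumes "solitary_wave_family c_plus \<phi>" "symplectic_gram c_plus \<phi>"
    and "1 < c_minus" "0 < a" "decays_faster a c_minus c_plus \<phi>" "c \<in> {c_minus<..<c_plus}"
  obtains \<beta> K where "a < \<beta>"
    "solitary_wave \<phi> c (\<lambda>x. vector_derivative (\<phi> c) (at x))
       (\<lambda>x. vector_derivative (\<lambda>c'. \<phi> c' x) (at c)) \<beta> K"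
proof -
  let ?I = "{1<..c_plus}"
  \<comment> \<open>At an interior speed the derivatives within the interval supplied by
    \<open>Ck_on\<close> are two-sided.\<close>
  have c: "c \<in> interior ?I" "c \<in> ?I" "c \<in> {1<..<c_plus}" "c \<in> {c_minus..<c_plus}"
    using assms by (auto intro!: interiorI[of "{1<..<c_plus}"])
  have "Ck_on (Suc 0) ?I \<phi>" using assms(1) unfolding solitary_wave_family_def by blast
  then obtain fc fx where d: "\<And>c x. c \<in> ?I \<Longrightarrow>
        ((\<lambda>c'. \<phi> c' x) has_vector_derivative fc c x) (at c within ?I) \<and>
        (\<phi> c has_vector_derivative fx c x) (at x)"
    and cont: "continuous_on (?I \<times> UNIV) (\<lambda>(c, x). fc c x)"
      "continuous_on (?I \<times> UNIV) (\<lambda>(c, x). fx c x)"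
    unfolding Ck_on.simps by blast
  have dc: "((\<lambda>c'. \<phi> c' x) has_vector_derivative fc c x) (at c)" for x
    using d[OF c(2), of x] at_within_interior[OF c(1)] by simp
  have dx: "(\<phi> c has_vector_derivative fx c x) (at x)" for x using d[OF c(2)] by blast
  have [simp]: "vector_derivative (\<phi> c) (at x) = fx c x"
    "vector_derivative (\<lambda>c'. \<phi> c' x) (at c) = fc c x" for x
    using vector_derivative_at[OF dx] vector_derivative_at[OF dc] by blast+
  have slice: "continuous_on UNIV (h c)" if "continuous_on (?I \<times> UNIV) (\<lambda>(c, x). h c x)"
    for h :: "real \<Rightarrow> real \<Rightarrow> real^2"
  proof -
    have "continuous_on UNIV (\<lambda>x::real. (c, x))" by (intro continuous_on_Pair continuous_on_const continuous_on_id)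
    moreover have "range (Pair c) \<subseteq> ?I \<times> UNIV" using c(2) by blast
    ultimately show ?thesis using continuous_on_compose2[OF that] by fastforce
  qed
  obtain \<beta> K where \<beta>: "a < \<beta>" and K: "\<And>x. norm (\<phi> c x) \<le> K * exp (- \<beta> * \<bar>x\<bar>) \<and>
       norm (vector_derivative (\<phi> c) (at x)) \<le> K * exp (- \<beta> * \<bar>x\<bar>) \<and>
       norm (vector_derivative (\<lambda>c'. \<phi> c' x) (at c)) \<le> K * exp (- \<beta> * \<bar>x\<bar>)"
    using assms(5) c(4) unfolding decays_faster_def by meson
  have "solitary_wave \<phi> c (fx c) (fc c) \<beta> K"
  proof
    show "0 < \<beta>" using \<beta> assms by simp
    show "continuous_on UNIV (fx c)" "continuous_on UNIV (fc c)" by (rule slice cont)+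
    show "0 < \<alpha>\<^sub>0 \<phi> c" using assms(2) c(3) by (simp add: symplectic_gram_def)
  qed (use dx dc K assms(2) c(3) in \<open>auto simp: symplectic_gram_def\<close>)
  then show thesis using that[OF \<beta>] by simp
qed

theorem proposition4p1:
  fixes c_plus c_minus a c_star \<sigma> \<alpha> :: real
    and \<phi> :: "real \<Rightarrow> real \<Rightarrow> real^2"
    and A :: "real \<Rightarrow> ell2 \<Rightarrow>\<^sub>L ell2"
    and M :: "'w measure"
    and \<kappa> :: "int \<Rightarrow> 'w \<Rightarrow> real"
    and \<eta> :: "int \<Rightarrow> real \<Rightarrow> 'w \<Rightarrow> real^2"
  assumes "solitary_wave_family c_plus \<phi>"
    and "symplectic_gram c_plus \<phi>"
    and "1 < c_minus" and "c_minus < c_plus"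
    and "a > 0"
    and "decays_faster a c_minus c_plus \<phi>"
    and "prob_space M"
    and "prob_space.indep_vars M (\<lambda>_. borel) \<kappa> UNIV"
    and "\<And>i j. distr M borel (\<kappa> i) = distr M borel (\<kappa> j)"
    and "\<And>j. prob_space.expectation M (\<kappa> j) = 0"
    and "\<And>j. prob_space.variance M (\<kappa> j) = 1"
    and "\<And>j. AE \<omega> in M. \<kappa> j \<omega> \<in> {-\<alpha>..\<alpha>}"
    and "\<sigma> \<ge> 0" and "\<sigma> * \<alpha> < 1"
    and "c_star \<in> {c_minus<..<c_plus}"
    and "linearly_stable \<phi> a c_star A"
    and "AE \<omega> in M. solves_forced_equation \<phi> c_star A (\<lambda>j. \<kappa> j \<omega>) (\<lambda>j t. \<eta> j t \<omega>)"
  shows "\<exists>\<eta>_inf :: real \<Rightarrow> 'w \<Rightarrow> real^2. \<forall>j :: int. \<forall>p\<in>{0..<1}.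
    converges_in_distribution (completion M)
      (\<lambda>n. \<eta> (j + int (Suc n)) ((real (Suc n) + p) / c_star))
      (\<eta>_inf (of_int j - p))"
proof -
  interpret prob_space M by fact
  obtain \<beta> K where \<beta>: "a < \<beta>" and sw: "solitary_wave \<phi> c_star
      (\<lambda>x. vector_derivative (\<phi> c_star) (at x))
      (\<lambda>x. vector_derivative (\<lambda>c'. \<phi> c' x) (at c_star)) \<beta> K"
    using solitary_wave_at_speed[OF assms(1,2,3,5,6,15)] by blast
  obtain U L b where U: "generates_evolution_family (\<lambda>t w. J_ell2 (A (c_star * t) w)) U"
    and Lb: "0 < L" "0 < b"
    and stable: "\<And>t s w. s \<le> t \<Longrightarrow> weighted_summable a (c_star * s) (ell2_seq w) \<Longrightarrow>
         \<Omega> (d_xi \<phi> (c_star * s) c_star) (ell2_seq w) = 0 \<Longrightarrow>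
         \<Omega> (d_c \<phi> (c_star * s) c_star) (ell2_seq w) = 0 \<Longrightarrow>
         weighted_summable a (c_star * t) (ell2_seq (U t s w)) \<and>
         weighted_norm a (c_star * t) (ell2_seq (U t s w))
           \<le> L * exp (- b * (t - s)) * weighted_norm a (c_star * s) (ell2_seq w)"
    using assms(16) unfolding linearly_stable_def by blast
  have c: "0 < c_star" using assms(3,15) by simp
  interpret stable_wave \<phi> c_star "\<lambda>x. vector_derivative (\<phi> c_star) (at x)"
      "\<lambda>x. vector_derivative (\<lambda>c'. \<phi> c' x) (at c_star)" \<beta> K a A U L b
    using assms(16)
    by (intro stable_wave.intro sw stable_wave_axioms.intro assms(5) \<beta> c U Lb stable)
      (simp_all add: linearly_stable_def)
  \<comment> \<open>The absolute value gives a nonnegative bound without a prior argument about the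
    sign of \<open>\<alpha>\<close>.\<close>
  define B where "B = \<bar>\<alpha>\<bar>"
  have B: "0 \<le> B" by (simp add: B_def)
  define \<Phi> where "\<Phi> j p S f = response (p / c_star) j S (clamp_seq B f)" for j p S f
  \<comment> \<open>For \<open>p\<close> in \<open>[0, 1)\<close> the number
    \<open>x = j - p\<close> determines \<open>j\<close> as its ceiling and \<open>p\<close> as the
    remainder, so one function of \<open>x\<close> serves all sites and phases.\<close>
  define \<eta>_inf where "\<eta>_inf x \<omega> = \<Phi> \<lceil>x\<rceil> (of_int \<lceil>x\<rceil> - x) {..(of_int \<lceil>x\<rceil> - x) / c_star} (\<lambda>i. \<kappa> i \<omega>)" for x \<omega>
  have rv: "random_variable borel (\<kappa> i)" for i
    using assms(8) by (simp add: indep_vars_def)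
  have seq: "(\<lambda>\<omega> i. \<kappa> (i + d) \<omega>) \<in> borel_measurable M" for d
    by (rule measurable_coordinatewise_then_product) (rule rv)
  have "converges_in_distribution (completion M)
      (\<lambda>n. \<eta> (j + int (Suc n)) ((real (Suc n) + p) / c_star)) (\<eta>_inf (of_int j - p))"
    if p: "p \<in> {0..<1}" for j p
  proof -
    have "\<lceil>of_int j - p\<rceil> = j" using p by (simp add: ceiling_eq_iff)
    then have \<eta>_inf: "\<eta>_inf (of_int j - p) = (\<lambda>\<omega>. \<Phi> j p {..p / c_star} (\<lambda>i. \<kappa> i \<omega>))"
      by (simp add: \<eta>_inf_def fun_eq_iff)
    define T where "T n = {- (real (Suc n) / c_star)..p / c_star}" for n
    have T: "T n \<in> sets borel" "T n \<subseteq> {..p / c_star}" for n by (auto simp: T_def)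
    have \<Phi>: "\<Phi> j p (T n) \<in> borel_measurable borel" for n
      unfolding \<Phi>_def[abs_def]
      by (intro borel_measurable_continuous_onI continuous_response_clamp B T)
    show ?thesis
      unfolding \<eta>_inf
    \<comment> \<open>\<open>Z\<close> keeps the translated noise and equals the solution almost
      surely; \<open>Y\<close> uses the untranslated noise, so only its integration interval changes
      with \<open>n\<close>.\<close>
    proof (rule converges_in_distributionI[OF assms(7),
          where Z = "\<lambda>n \<omega>. \<Phi> j p (T n) (\<lambda>i. \<kappa> (i + int (Suc n)) \<omega>)"
            and Y = "\<lambda>n \<omega>. \<Phi> j p (T n) (\<lambda>i. \<kappa> i \<omega>)"])
      show Zm: "(\<lambda>\<omega>. \<Phi> j p (T n) (\<lambda>i. \<kappa> (i + int (Suc n)) \<omega>)) \<in> borel_measurable M" for n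
        by (rule measurable_compose[OF seq \<Phi>])
      show Ym: "(\<lambda>\<omega>. \<Phi> j p (T n) (\<lambda>i. \<kappa> i \<omega>)) \<in> borel_measurable M" for n
        using measurable_compose[OF seq[of 0] \<Phi>] by simp
      show "distr M borel (\<lambda>\<omega>. \<Phi> j p (T n) (\<lambda>i. \<kappa> (i + int (Suc n)) \<omega>))
          = distr M borel (\<lambda>\<omega>. \<Phi> j p (T n) (\<lambda>i. \<kappa> i \<omega>))" for n
        using distr_distr[OF \<Phi> seq[of "int (Suc n)"]] distr_distr[OF \<Phi> seq[of 0]]
          distr_shift_iid[OF assms(8,9), of "int (Suc n)"]
        by (simp add: o_def)
      \<comment> \<open>The lattice is countable, so a single null set works for all sites.\<close>
      have "AE \<omega> in M. \<forall>i. \<kappa> i \<omega> \<in> {-\<alpha>..\<alpha>}" using assms(12) by (simp add: AE_all_countable)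
      with assms(17) show "AE \<omega> in M. \<eta> (j + int (Suc n)) ((real (Suc n) + p) / c_star) \<omega>
          = \<Phi> j p (T n) (\<lambda>i. \<kappa> (i + int (Suc n)) \<omega>)" for n
      proof eventually_elim
        case (elim \<omega>)
        have le: "\<bar>\<kappa> i \<omega>\<bar> \<le> B" for i
          using spec[OF elim(2), of i] by (auto simp: B_def)
        show ?case
          unfolding \<Phi>_def T_def using p
          by (subst clamp_seq_eq[OF le]) (intro solution_eq_response[OF elim(1) le]; simp)
      qed
      show "(\<lambda>n. \<Phi> j p (T n) (\<lambda>i. \<kappa> i \<omega>)) \<longlonglongrightarrow> \<Phi> j p {..p / c_star} (\<lambda>i. \<kappa> i \<omega>)" for \<omega>
        unfolding \<Phi>_def
      proof (rule response_tendsto[OF tendsto_const abs_clamp_seq_le[OF B] T])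
        fix s
        \<comment> \<open>From this index on the lower end of \<open>T n\<close> lies below
          \<open>s\<close>, so the indicators at \<open>s\<close> are eventually constant.\<close>
        obtain N where N: "- s * c_star \<le> real N" using real_arch_simple by blast
        have "indicator (T n) s = (indicator {..p / c_star} s :: real)" if "n \<ge> N" for n
        proof -
          have "- (real (Suc n) / c_star) \<le> s"
            using N that c by (simp add: field_simps)
          then show ?thesis by (simp add: T_def indicator_def)
        qed
        then show "(\<lambda>n. indicator (T n) s :: real) \<longlonglongrightarrow> indicator {..p / c_star} s"
          by (intro tendsto_eventually) (auto simp: eventually_sequentially)
      qed auto
    qed
  qed
  then show ?thesis by blast
qed

end
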